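(* Let $X$ be an infinite set and $\mathcal{P} = \{\Sigma_0, \dots, \Sigma_{n-1}\}$ a finite partition of $X$ into $n\geq 2$ parts. Then the maximal subsemigroups of $I_X$ which contain $\operatorname{Stab}(\mathcal{P})$ but not $\operatorname{Sym}(X)$ are exactly $$A_{\mathcal{P}} = \{f \in I_X : \rho_f \in \operatorname{Sym}(n) \text{ or } \operatorname{dom}(\rho_f) \neq n\},$$ $$A_{\mathcal{P}}^{-1} = \{f \in I_X : \rho_f \in \operatorname{Sym}(n) \text{ or } \operatorname{im}(\rho_f) \neq n\},$$ and the unique maximal inverse subsemigroup of $I_X$ containing $\operatorname{Stab}(\mathcal{P})$ but not $\operatorname{Sym}(X)$ is $$A_{\mathcal{P}} \cap A_{\mathcal{P}}^{-1} = \{f \in I_X : \rho_f \in \operatorname{Sym}(n) \text{ or } \operatorname{dom}(\rho_f) \neq n \neq \operatorname{im}(\rho_f)\}.$$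
   Context: $I_X$ denotes the symmetric inverse monoid on $X$: the set of all injective partial functions from $X$ to $X$ (bijections between subsets of $X$, including the empty one) under composition of partial functions, written on the right and composed from left to right. $\operatorname{Sym}(X)\subseteq I_X$ is the group of all permutations of $X$. A finite partition of $X$ is a partition $\mathcal{P}=\{\Sigma_0,\dots,\Sigma_{n-1}\}$ of $X$ into $n\ge 2$ (distinct) parts with $|\Sigma_i|=|X|$ for all $i\in n=\{0,\dots,n-1\}$. $\operatorname{Stab}(\mathcal{P})=\{f\in\operatorname{Sym}(X): (\forall i\in n)(\exists j\in n)(\Sigma_i f=\Sigma_j)\}$. For $f\in I_X$ and $\Sigma\subseteq X$, $\Sigma f=\{xf:x\in\Sigma\cap\operatorname{dom}(f)\}$. For $f\in I_X$, $\rho_f$ is the binary relation $\rho_f=\{(i,j)\in n\times n: |\Sigma_i f\cap\Sigma_j|=|X|\}$ on $n$. For a binary relation $\rho$ on $n$, $\operatorname{dom}(\rho)=\{i\in n:(i,j)\in\rho\text{ for some }j\in n\}$ and $\operatorname{im}(\rho)=\{j\in n:(i,j)\in\rho\text{ for some }i\in n\}$; $\operatorname{Sym}(n)$ is the set of permutations of $n$, viewed as binary relations. For $M\subseteq I_X$, $M^{-1}=\{f^{-1}:f\in M\}$. An inverse subsemigroup is a subsemigroup closed under $f\mapsto f^{-1}$. A maximal subsemigroup (respectively maximal inverse subsemigroup) is a maximal element, under containment, of the set of all proper subsemigroups (respectively proper inverse subsemigroups). *)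

theory Defs
  imports Main "HOL-Library.Equipollence" "HOL-Library.Disjoint_Sets"
begin

text \<open>
  A partial function is identified with its graph, a relation of type \<open>'a rel\<close>. In these terms
  the left-to-right composite of \<open>f\<close> and \<open>g\<close> is \<open>f O g\<close>, the inverse of \<open>f\<close> is
  \<open>f\<inverse>\<close>, and the image of \<open>S\<close> (more precisely of the part of \<open>S\<close> in the
  domain of \<open>f\<close>) is \<open>f `` S\<close>. Equality of cardinals is \<open>\<approx>\<close>; \<open>card\<close> would be
  meaningless on infinite sets.
\<close>

definition sym_inv_monoid :: "'a set \<Rightarrow> 'a rel set" where
  "sym_inv_monoid X = {f. f \<subseteq> X \<times> X \<and> single_valued f \<and> single_valued (f\<inverse>)}"

text \<open>With \<open>X = {..<n}\<close> this is also the group of permutations of \<open>n\<close>, as binary relations.\<close>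

definition Sym :: "'a set \<Rightarrow> 'a rel set" where
  "Sym X = {f \<in> sym_inv_monoid X. Domain f = X \<and> Range f = X}"

definition subsemigroup :: "'a rel set \<Rightarrow> 'a rel set \<Rightarrow> bool" where
  "subsemigroup M S \<longleftrightarrow> M \<subseteq> S \<and> (\<forall>f\<in>M. \<forall>g\<in>M. f O g \<in> M)"

definition inverse_subsemigroup :: "'a rel set \<Rightarrow> 'a rel set \<Rightarrow> bool" where
  "inverse_subsemigroup M S \<longleftrightarrow> subsemigroup M S \<and> (\<forall>f\<in>M. f\<inverse> \<in> M)"

definition maximal_subsemigroup :: "'a rel set \<Rightarrow> 'a rel set \<Rightarrow> bool" where
  "maximal_subsemigroup M S \<longleftrightarrow>
     subsemigroup M S \<and> M \<noteq> S \<and>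
     (\<forall>N. subsemigroup N S \<and> N \<noteq> S \<and> M \<subseteq> N \<longrightarrow> N = M)"

definition maximal_inverse_subsemigroup :: "'a rel set \<Rightarrow> 'a rel set \<Rightarrow> bool" where
  "maximal_inverse_subsemigroup M S \<longleftrightarrow>
     inverse_subsemigroup M S \<and> M \<noteq> S \<and>
     (\<forall>N. inverse_subsemigroup N S \<and> N \<noteq> S \<and> M \<subseteq> N \<longrightarrow> N = M)"

text \<open>
  The parts are \<open>P 0, \<dots>, P (n - 1)\<close>; values of \<open>P\<close> beyond that are irrelevant. For infinite
  \<open>X\<close> the parts are nonempty, hence distinct, by the cardinality condition.
\<close>

definition finite_partition :: "'a set \<Rightarrow> nat \<Rightarrow> (nat \<Rightarrow> 'a set) \<Rightarrow> bool" where
  "finite_partition X n P \<longleftrightarrow>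
     n \<ge> 2 \<and> (\<Union>i<n. P i) = X \<and> disjoint_family_on P {..<n} \<and> (\<forall>i<n. P i \<approx> X)"

definition Stab :: "'a set \<Rightarrow> nat \<Rightarrow> (nat \<Rightarrow> 'a set) \<Rightarrow> 'a rel set" where
  "Stab X n P = {f \<in> Sym X. \<forall>i<n. \<exists>j<n. f `` P i = P j}"

definition rho :: "'a set \<Rightarrow> nat \<Rightarrow> (nat \<Rightarrow> 'a set) \<Rightarrow> 'a rel \<Rightarrow> nat rel" where
  "rho X n P f = {(i, j). i < n \<and> j < n \<and> (f `` P i) \<inter> P j \<approx> X}"

definition A_semi :: "'a set \<Rightarrow> nat \<Rightarrow> (nat \<Rightarrow> 'a set) \<Rightarrow> 'a rel set" where
  "A_semi X n P = {f \<in> sym_inv_monoid X.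
     rho X n P f \<in> Sym {..<n} \<or> Domain (rho X n P f) \<noteq> {..<n}}"

definition inverses :: "'a rel set \<Rightarrow> 'a rel set" where
  "inverses M = {f\<inverse> | f. f \<in> M}"

end

theory Submission
  imports Defs
begin

text \<open>
  Write \<open>\<kappa>\<close> for the cardinality of \<open>X\<close>, call a subset of \<open>X\<close> large if it has cardinality \<open>\<kappa>\<close>,
  and write \<open>A\<close> for \<open>A_semi X n P\<close>. Since \<open>\<kappa>\<close> is infinite and the partition is finite, every large
  set has a large intersection with some block; hence \<open>rho (f O g) \<subseteq> rho f O rho g\<close>, which makes \<open>A\<close>
  a subsemigroup. The relation of an element of the stabiliser is a permutation, whereas a permutation
  of \<open>X\<close> that sends large parts of one block to two different blocks lies outside \<open>A\<close>.

  The stabiliser is rich: every partial injection that carries blocks into blocks along a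
  permutation of the indices, with complements of matching size in every block, extends to an
  element of \<open>Stab X n P\<close> (\<open>Stab_extension\<close>). Call \<open>t\<close> roomy if it has domain \<open>X\<close> and its image
  misses a large part of every block. If a subsemigroup \<open>M\<close> contains the stabiliser and a roomy
  \<open>t\<close>, the image of \<open>t\<close> can be moved, inside \<open>M\<close>, into any prescribed set that meets every block in
  a large set. Let \<open>h\<close> be an element of \<open>M\<close> outside \<open>A\<close>. Its relation \<open>rho h\<close> has full domain and
  is not a permutation, so it contains the graph of a noninjective map \<open>d\<close>. After moving the image
  into the points that \<open>h\<close> sends from block \<open>i\<close> to block \<open>d i\<close>, composing with \<open>h\<close> merges two of
  the blocks that the image meets. Iteration produces a roomy \<open>f \<in> M\<close> whose image lies in one block
  (\<open>ex_roomy_into_one_block\<close>). Such an \<open>f\<close> is used in two ways.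

  (1) As \<open>f O f\<inverse>\<close> is the identity, any \<open>z\<close> equals \<open>f O (f\<inverse> O z)\<close>, and \<open>f\<inverse> O z\<close> has its domain
  in one block, hence lies in \<open>A\<close>. As \<open>A\<close> contains roomy elements, namely injections of every block
  into its own half, a subsemigroup properly containing \<open>A\<close> is everything, and \<open>A\<close> is maximal; by inversion so is its inverse. The factorisation \<open>z = f O (f\<inverse> O z O f) O f\<inverse>\<close>
  does the same for \<open>A \<inter> A\<inverse>\<close> among inverse subsemigroups.

  (2) If \<open>g\<close> is a second such element, possibly of another subsemigroup, every permutation \<open>q\<close> of \<open>X\<close> is \<open>f O s O g\<inverse>\<close> for some
  \<open>s\<close> in the stabiliser, because \<open>f\<inverse> O q O g\<close> maps a part of one block into one block and both
  parts have large complements (\<open>Sym_factors_through_one_block\<close>).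

  Now let \<open>M\<close> be maximal, contain the stabiliser, but not all permutations. If \<open>M\<close> had no roomy
  element, the sets that inject into the complement of the image of some \<open>u \<in> M\<close> with domain \<open>X\<close>
  would form an ideal of sets that does not contain \<open>X\<close>. The elements \<open>f\<close> for which
  \<open>X - Range f\<close> lies in this ideal whenever \<open>X - Domain f\<close> does form a proper subsemigroup that
  contains \<open>M\<close> and all permutations (\<open>no_roomy_imp_in_proper_subsemigroup\<close>), contrary to
  maximality. So \<open>M\<close> has a roomy element, and by symmetry so has its inverse. If neither \<open>M\<close> nor its
  inverse were contained in \<open>A\<close>, then (2) would put every permutation into \<open>M\<close>. Hence \<open>M\<close> is
  contained in \<open>A\<close> or in its inverse, and equal to it by maximality. For inverse
  subsemigroups the same argument works with the proper subsemigroup just constructed replaced by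
  its intersection with its inverse.
\<close>

section \<open>Cardinalities\<close>

unbundle cardinal_syntax

lemma infinite_Un_eqpoll_cases:
  assumes "infinite X" and "A \<union> B \<approx> X"
  shows "A \<approx> X \<or> B \<approx> X"
proof (rule ccontr)
  assume "\<not> ?thesis"
  moreover have "A \<lesssim> X" "B \<lesssim> X"
    using assms(2) by (meson Un_upper1 Un_upper2 eqpoll_imp_lepoll lepoll_trans subset_imp_lepoll)+
  ultimately have "A \<prec> X" "B \<prec> X"
    by (auto simp: lesspoll_def)
  then have "|A| <o |X|" "|B| <o |X|"
    by (metis card_of_ordLeq eqpoll_iff_card_of_ordIso lepoll_def lesspoll_def
        ordLeq_iff_ordLess_or_ordIso)+
  then have "|A \<union> B| <o |X|"
    using card_of_Un_ordLess_infinite assms(1) by blast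
  then show False
    using assms(2) by (simp add: eqpoll_iff_card_of_ordIso not_ordLess_ordIso)
qed

lemma infinite_UN_eqpoll_cases:
  assumes "infinite X" and "finite I" and "(\<Union>i\<in>I. A i) \<approx> X"
  shows "\<exists>i\<in>I. A i \<approx> X"
  using assms(2,3)
proof (induction I)
  case empty
  then show ?case
    using assms(1) eqpoll_sym by fastforce
next
  case (insert i I)
  then have "A i \<approx> X \<or> (\<Union>i\<in>I. A i) \<approx> X"
    using infinite_Un_eqpoll_cases[OF assms(1)] by simp
  then show ?case
    using insert.IH by auto
qed

text \<open>
  The two halves are the images of the two summands under a bijection of \<open>Y <+> Y\<close> onto \<open>Y\<close>.
\<close>

lemma infinite_halves:
  assumes "infinite Y"
  obtains A B where "A \<union> B = Y" "A \<inter> B = {}" "A \<approx> Y" "B \<approx> Y"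
proof -
  have "|Y <+> Y| =o |Y|"
    using assms card_of_Plus_infinite1 card_of_refl ordIso_iff_ordLeq by blast
  then obtain f where f: "bij_betw f (Y <+> Y) Y"
    using card_of_ordIso by blast
  let ?A = "(\<lambda>y. f (Inl y)) ` Y" and ?B = "(\<lambda>y. f (Inr y)) ` Y"
  have eq: "f x = f y \<longleftrightarrow> x = y" if "x \<in> Y <+> Y" "y \<in> Y <+> Y" for x y
    using f that by (auto simp: bij_betw_def inj_on_def)
  have "?A \<union> ?B = f ` (Y <+> Y)"
    by (auto simp: Plus_def)
  then have "?A \<union> ?B = Y"
    using f by (simp add: bij_betw_def)
  moreover have "?A \<inter> ?B = {}"
    using eq by fastforce
  moreover have "inj_on (\<lambda>y. f (Inl y)) Y" "inj_on (\<lambda>y. f (Inr y)) Y"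
    using eq by (auto simp: inj_on_def)
  then have "?A \<approx> Y" "?B \<approx> Y"
    by (simp_all add: inj_on_image_eqpoll_self)
  ultimately show ?thesis
    using that by blast
qed

text \<open>
  If the complement of \<open>A\<close> is smaller than \<open>S\<close>, then \<open>A\<close> is as large as \<open>S\<close>, and half of \<open>A\<close> will do.
\<close>

lemma eqpoll_subset_with_large_complement:
  assumes "infinite S" and "A \<subseteq> S"
  obtains A' where "A' \<subseteq> A" "A' \<approx> A" "S - A' \<approx> S"
proof (cases "S - A \<approx> S")
  case True
  then show ?thesis
    using that[of A] by simp
next
  case False
  have "A \<union> (S - A) = S"
    using assms(2) by blast
  then have A: "A \<approx> S"
    using infinite_Un_eqpoll_cases[OF assms(1), of A "S - A"] False by simp
  then have "infinite A"
    using assms(1) eqpoll_finite_iff by blast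
  then obtain B C where "B \<union> C = A" "B \<inter> C = {}" "B \<approx> A" "C \<approx> A"
    by (rule infinite_halves)
  moreover from this have "S - B \<approx> S"
    using A assms(2) subset_imp_lepoll[of C "S - B"] subset_imp_lepoll[of "S - B" S]
    by (metis Diff_subset Un_subset_iff Diff_disjoint Diff_mono Diff_triv
        eqpoll_sym eqpoll_imp_lepoll lepoll_antisym lepoll_trans)
  ultimately show ?thesis
    using that[of B] by blast
qed

section \<open>Partial injections and inversion\<close>

lemma Image_lepoll: "single_valued f \<Longrightarrow> f `` S \<lesssim> S"
  by (rule lepoll_relational_full[where R = "\<lambda>x y. (x, y) \<in> f"])
    (auto simp: single_valued_def)

lemma Image_eqpoll:
  assumes "single_valued f" and "single_valued (f\<inverse>)" and "S \<subseteq> Domain f"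
  shows "f `` S \<approx> S"
proof -
  have "f\<inverse> `` (f `` S) = S"
    using assms unfolding single_valued_def by blast
  then have "S \<lesssim> f `` S"
    using Image_lepoll[OF assms(2), of "f `` S"] by simp
  then show ?thesis
    using Image_lepoll[OF assms(1)] lepoll_antisym by blast
qed

text \<open>
  This builds a partial injection block by block from the equality of the cardinalities of
  corresponding parts.
\<close>

lemma glue_eqpoll_families:
  fixes D E :: "'i \<Rightarrow> 'a set"
  assumes D: "disjoint_family_on D I" and E: "disjoint_family_on E I"
    and eq: "\<And>i. i \<in> I \<Longrightarrow> D i \<approx> E i"
  obtains u where "single_valued u" "single_valued (u\<inverse>)"
    "Domain u = (\<Union>i\<in>I. D i)" "Range u = (\<Union>i\<in>I. E i)"
    "u \<subseteq> (\<Union>i\<in>I. D i \<times> E i)" "\<forall>i\<in>I. u `` D i = E i"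
proof -
  obtain b where b: "\<And>i. i \<in> I \<Longrightarrow> bij_betw (b i) (D i) (E i)"
    using eq unfolding eqpoll_def by metis
  define u where "u = {(x, y). \<exists>i\<in>I. x \<in> D i \<and> y = b i x}"
  have same: "i = j" if "i \<in> I" "j \<in> I" "x \<in> D i \<and> x \<in> D j \<or> x \<in> E i \<and> x \<in> E j" for i j x
    using that D E unfolding disjoint_family_on_def by blast
  have bE: "b i x \<in> E i" if "i \<in> I" "x \<in> D i" for i x
    using b that by (meson bij_betw_apply)
  have "single_valued u"
    unfolding single_valued_def u_def using same by blast
  moreover have "single_valued (u\<inverse>)"
    unfolding single_valued_def u_def
  proof clarify
    fix y x i x' j
    assume *: "i \<in> I" "x \<in> D i" "j \<in> I" "x' \<in> D j" "b i x = b j x'"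
    then have "i = j"
      using same bE by metis
    then show "x = x'"
      using * b unfolding bij_betw_def inj_on_def by blast
  qed
  moreover have "Domain u = (\<Union>i\<in>I. D i)"
    unfolding u_def by auto
  moreover have "u \<subseteq> (\<Union>i\<in>I. D i \<times> E i)"
    unfolding u_def using bE by blast
  moreover have im: "u `` D i = E i" if "i \<in> I" for i
  proof -
    have "u `` D i = b i ` D i"
      unfolding u_def using same that by blast
    then show ?thesis
      using b[OF that] by (simp add: bij_betw_def)
  qed
  moreover have "Range u = (\<Union>i\<in>I. E i)"
    using im calculation(4) by blast
  ultimately show ?thesis
    by (intro that ballI)
qed

lemma sym_inv_monoid_comp:
  "f \<in> sym_inv_monoid X \<Longrightarrow> g \<in> sym_inv_monoid X \<Longrightarrow> f O g \<in> sym_inv_monoid X"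
  unfolding sym_inv_monoid_def single_valued_def by blast

lemma sym_inv_monoid_converse:
  "f \<in> sym_inv_monoid X \<Longrightarrow> f\<inverse> \<in> sym_inv_monoid X"
  unfolding sym_inv_monoid_def by auto

lemma sym_inv_monoid_right_unique:
  "f \<in> sym_inv_monoid X \<Longrightarrow> (x, y) \<in> f \<Longrightarrow> (x, z) \<in> f \<Longrightarrow> y = z"
  unfolding sym_inv_monoid_def single_valued_def by blast

lemma sym_inv_monoid_left_unique:
  "f \<in> sym_inv_monoid X \<Longrightarrow> (x, z) \<in> f \<Longrightarrow> (y, z) \<in> f \<Longrightarrow> x = y"
  unfolding sym_inv_monoid_def single_valued_def by blast

lemma sym_inv_monoid_in_carrier:
  "f \<in> sym_inv_monoid X \<Longrightarrow> (x, y) \<in> f \<Longrightarrow> x \<in> X \<and> y \<in> X"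
  unfolding sym_inv_monoid_def by blast

lemma sym_inv_monoid_Image_eqpoll:
  "f \<in> sym_inv_monoid X \<Longrightarrow> S \<subseteq> Domain f \<Longrightarrow> f `` S \<approx> S"
  unfolding sym_inv_monoid_def by (simp add: Image_eqpoll)

lemma sym_inv_monoid_Image_lepoll:
  "f \<in> sym_inv_monoid X \<Longrightarrow> f `` S \<lesssim> S"
  unfolding sym_inv_monoid_def by (simp add: Image_lepoll)

lemma subsemigroup_comp:
  "subsemigroup M S \<Longrightarrow> f \<in> M \<Longrightarrow> g \<in> M \<Longrightarrow> f O g \<in> M"
  unfolding subsemigroup_def by blast

lemma Sym_converse: "r \<in> Sym S \<Longrightarrow> r\<inverse> \<in> Sym S"
  by (auto simp: Sym_def sym_inv_monoid_converse)

lemma inverses_iff: "f \<in> inverses M \<longleftrightarrow> f\<inverse> \<in> M"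
proof
  assume "f\<inverse> \<in> M"
  then show "f \<in> inverses M"
    unfolding inverses_def by (intro CollectI exI[of _ "f\<inverse>"]) simp
qed (auto simp: inverses_def)

lemma inverses_inverses: "inverses (inverses M) = M"
  by (auto simp: inverses_iff)

lemma inverses_mono: "M \<subseteq> N \<Longrightarrow> inverses M \<subseteq> inverses N"
  by (auto simp: inverses_iff)

lemma inverses_sym_inv_monoid: "inverses (sym_inv_monoid X) = sym_inv_monoid X"
proof (rule set_eqI)
  fix f show "f \<in> inverses (sym_inv_monoid X) \<longleftrightarrow> f \<in> sym_inv_monoid X"
    using sym_inv_monoid_converse[of f X] sym_inv_monoid_converse[of "f\<inverse>" X]
    by (auto simp: inverses_iff)
qed

lemma inverses_Sym: "inverses (Sym X) = Sym X"
proof (rule set_eqI)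
  fix f show "f \<in> inverses (Sym X) \<longleftrightarrow> f \<in> Sym X"
    using Sym_converse[of f X] Sym_converse[of "f\<inverse>" X] by (auto simp: inverses_iff)
qed

lemma subsemigroup_inverses:
  "subsemigroup M (sym_inv_monoid X) \<Longrightarrow> subsemigroup (inverses M) (sym_inv_monoid X)"
  unfolding subsemigroup_def
proof (elim conjE, intro conjI ballI)
  fix f g assume "\<forall>f\<in>M. \<forall>g\<in>M. f O g \<in> M" "f \<in> inverses M" "g \<in> inverses M"
  then show "f O g \<in> inverses M"
    by (simp add: inverses_iff converse_relcomp)
next
  assume "M \<subseteq> sym_inv_monoid X"
  then show "inverses M \<subseteq> sym_inv_monoid X"
    using inverses_mono[of M "sym_inv_monoid X"] by (simp add: inverses_sym_inv_monoid)
qed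

lemma maximal_subsemigroup_inverses:
  assumes "maximal_subsemigroup M (sym_inv_monoid X)"
  shows "maximal_subsemigroup (inverses M) (sym_inv_monoid X)"
  unfolding maximal_subsemigroup_def
proof (intro conjI allI impI)
  show "subsemigroup (inverses M) (sym_inv_monoid X)"
    using assms subsemigroup_inverses unfolding maximal_subsemigroup_def by blast
  show "inverses M \<noteq> sym_inv_monoid X"
    using assms inverses_inverses inverses_sym_inv_monoid unfolding maximal_subsemigroup_def by metis
  fix N assume N: "subsemigroup N (sym_inv_monoid X) \<and> N \<noteq> sym_inv_monoid X \<and> inverses M \<subseteq> N"
  then have "M \<subseteq> inverses N" "inverses N \<noteq> sym_inv_monoid X"
    using inverses_mono inverses_inverses inverses_sym_inv_monoid by metis+
  then have "inverses N = M"
    using assms N subsemigroup_inverses unfolding maximal_subsemigroup_def by blast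
  then show "N = inverses M"
    using inverses_inverses by metis
qed

lemma inverse_subsemigroup_inverses_eq:
  assumes "inverse_subsemigroup M S"
  shows "inverses M = M"
proof (rule set_eqI)
  have "g\<inverse> \<in> M" if "g \<in> M" for g
    using assms that unfolding inverse_subsemigroup_def by blast
  then have inv: "\<And>g. g \<in> M \<Longrightarrow> g\<inverse> \<in> M" .
  fix f
  show "f \<in> inverses M \<longleftrightarrow> f \<in> M"
    using inv[of f] inv[of "f\<inverse>"] by (auto simp: inverses_iff)
qed

lemma inverse_subsemigroup_Int_inverses:
  assumes "subsemigroup M (sym_inv_monoid X)"
  shows "inverse_subsemigroup (M \<inter> inverses M) (sym_inv_monoid X)"
proof -
  have "subsemigroup (M \<inter> inverses M) (sym_inv_monoid X)"
    using assms subsemigroup_inverses[OF assms] unfolding subsemigroup_def by blast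
  then show ?thesis
    by (simp add: inverse_subsemigroup_def inverses_iff)
qed

text \<open>
  This is what turns the inclusion of \<open>rho (f O g)\<close> in \<open>rho f O rho g\<close> into an equality when the
  right-hand side is a permutation.
\<close>

lemma Sym_subset_imp_eq:
  assumes "r \<in> Sym S" and "r' \<subseteq> r" and "Domain r' = S"
  shows "r' = r"
proof
  show "r \<subseteq> r'"
  proof clarify
    fix x y assume xy: "(x, y) \<in> r"
    then have "x \<in> S"
      using assms(1) unfolding Sym_def by blast
    then obtain y' where "(x, y') \<in> r'"
      using assms(3) by blast
    then show "(x, y) \<in> r'"
      using xy assms(1,2) unfolding Sym_def sym_inv_monoid_def single_valued_def by blast
  qed
qed (fact assms(2))

lemma Sym_comp:
  assumes "r \<in> Sym S" and "r' \<in> Sym S"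
  shows "r O r' \<in> Sym S"
proof -
  have r: "Domain r = S" "Range r = S" and r': "Domain r' = S" "Range r' = S"
    using assms by (auto simp: Sym_def)
  have "Domain (r O r') = Domain r" "Range (r O r') = Range r'"
    using r(2) r'(1) by blast+
  then show ?thesis
    using assms r(1) r'(2) sym_inv_monoid_comp[of r S r'] by (simp add: Sym_def)
qed

text \<open>
  Block permutations are needed only to bring one or two given blocks to given positions.
\<close>

lemma ex_bij_betw_two_points:
  fixes n :: nat
  assumes "i < n" "j < n" "i \<noteq> j" "a < n" "b < n" "a \<noteq> b"
  obtains p where "bij_betw p {..<n} {..<n}" "p i = a" "p j = b"
proof -
  have "card ({..<n} - {i, j}) = card ({..<n} - {a, b})"
    using assms by (simp add: card_Diff_subset)
  then obtain g where g: "bij_betw g ({..<n} - {i, j}) ({..<n} - {a, b})"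
    using finite_same_card_bij by blast
  let ?p = "g(i := a, j := b)"
  have 1: "bij_betw ?p ({..<n} - {i, j}) ({..<n} - {a, b})"
    using g by (rule bij_betw_cong[THEN iffD1, rotated]) auto
  have 2: "bij_betw ?p {i, j} {a, b}"
    using assms by (auto simp: bij_betw_def inj_on_def)
  have "bij_betw ?p (({..<n} - {i, j}) \<union> {i, j}) (({..<n} - {a, b}) \<union> {a, b})"
    using bij_betw_combine[OF 1 2] by auto
  moreover have "({..<n} - {i, j}) \<union> {i, j} = {..<n}" "({..<n} - {a, b}) \<union> {a, b} = {..<n}"
    using assms by auto
  ultimately have "bij_betw ?p {..<n} {..<n}"
    by simp
  moreover have "?p i = a" "?p j = b"
    using assms by auto
  ultimately show ?thesis
    by (intro that)
qed

lemma ex_bij_betw_point: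
  fixes n :: nat
  assumes "2 \<le> n" "i < n" "a < n"
  obtains p where "bij_betw p {..<n} {..<n}" "p i = a"
proof -
  have other: "\<exists>y<n. y \<noteq> x" for x
    using assms(1) by (intro exI[of _ "if x = 0 then 1 else 0"]) auto
  obtain j b where "j < n" "j \<noteq> i" "b < n" "b \<noteq> a"
    using other by blast
  then show ?thesis
    using ex_bij_betw_two_points[of i n j a b] assms that by metis
qed

section \<open>Extending partial injections to the stabiliser\<close>

locale finitely_partitioned =
  fixes X :: "'a set" and n :: nat and P :: "nat \<Rightarrow> 'a set"
  assumes infinite_X: "infinite X" and partition: "finite_partition X n P"
begin

lemma n_ge_2: "2 \<le> n"
  using partition by (simp add: finite_partition_def)

lemma X_eq: "X = (\<Union>i<n. P i)"
  using partition by (simp add: finite_partition_def)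

lemma P_subset: "i < n \<Longrightarrow> P i \<subseteq> X"
  using X_eq by blast

lemma P_unique: "i < n \<Longrightarrow> j < n \<Longrightarrow> x \<in> P i \<Longrightarrow> x \<in> P j \<Longrightarrow> i = j"
  using partition unfolding finite_partition_def disjoint_family_on_def by blast

lemma P_large: "i < n \<Longrightarrow> P i \<approx> X"
  using partition by (simp add: finite_partition_def)

lemma ex_block: "x \<in> X \<Longrightarrow> \<exists>i<n. x \<in> P i"
  using X_eq by blast

lemma large_mono: "Y \<approx> X \<Longrightarrow> Y \<subseteq> Z \<Longrightarrow> Z \<subseteq> X \<Longrightarrow> Z \<approx> X"
  by (meson eqpoll_imp_lepoll eqpoll_sym lepoll_antisym lepoll_trans subset_imp_lepoll)

lemma large_lepoll: "X \<lesssim> Z \<Longrightarrow> Z \<subseteq> X \<Longrightarrow> Z \<approx> X"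
  by (meson lepoll_antisym subset_imp_lepoll)

lemma large_nonempty: "Y \<approx> X \<Longrightarrow> Y \<noteq> {}"
  using infinite_X eqpoll_finite_iff by blast

text \<open>
  Finiteness of the partition is essential: a finite union of sets smaller than the infinite set
  \<open>X\<close> is smaller than \<open>X\<close>.
\<close>

lemma ex_large_block:
  assumes "Y \<approx> X" and "Y \<subseteq> X"
  shows "\<exists>i<n. P i \<inter> Y \<approx> X"
proof -
  have "(\<Union>i<n. P i \<inter> Y) = Y"
    using assms(2) X_eq by blast
  then have "(\<Union>i<n. P i \<inter> Y) \<approx> X"
    using assms(1) by simp
  then show ?thesis
    using infinite_UN_eqpoll_cases[OF infinite_X, of "{..<n}" "\<lambda>i. P i \<inter> Y"] by blast
qed

lemma large_halves:
  assumes "Y \<approx> X"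
  obtains A B where "A \<union> B = Y" "A \<inter> B = {}" "A \<approx> X" "B \<approx> X"
proof -
  have "infinite Y"
    using assms infinite_X eqpoll_finite_iff by blast
  then show ?thesis
    using infinite_halves assms eqpoll_trans that by metis
qed

lemma Stab_sym_inv: "s \<in> Stab X n P \<Longrightarrow> s \<in> sym_inv_monoid X"
  by (simp add: Stab_def Sym_def)

lemma Stab_Domain: "s \<in> Stab X n P \<Longrightarrow> Domain s = X"
  by (simp add: Stab_def Sym_def)

lemma Stab_Range: "s \<in> Stab X n P \<Longrightarrow> Range s = X"
  by (simp add: Stab_def Sym_def)

lemma Id_on_Stab: "Id_on X \<in> Stab X n P"
proof -
  have "\<exists>j<n. Id_on X `` P i = P j" if "i < n" for i
    using P_subset[OF that] that by (intro exI[of _ i]) auto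
  then show ?thesis
    by (auto simp: Stab_def Sym_def sym_inv_monoid_def single_valued_def)
qed

lemma Stab_permutes_blocks:
  assumes "s \<in> Stab X n P"
  obtains p where "bij_betw p {..<n} {..<n}" "\<And>i. i < n \<Longrightarrow> s `` P i = P (p i)"
proof -
  obtain p where p: "\<And>i. i < n \<Longrightarrow> p i < n \<and> s `` P i = P (p i)"
    using assms unfolding Stab_def by (simp) metis
  have "inj_on p {..<n}"
  proof (rule inj_onI)
    fix i j assume ij: "i \<in> {..<n}" "j \<in> {..<n}" "p i = p j"
    then have eq: "s `` P i = s `` P j"
      using p by simp
    obtain x where x: "x \<in> P i"
      using large_nonempty[OF P_large, of i] ij by auto
    then have "x \<in> Domain s"
      using P_subset ij Stab_Domain[OF assms] by auto
    then obtain y where "(x, y) \<in> s" by blast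
    moreover from this x obtain x' where "(x', y) \<in> s" "x' \<in> P j"
      using eq by blast
    ultimately show "i = j"
      using P_unique ij x sym_inv_monoid_left_unique[OF Stab_sym_inv[OF assms]] by blast
  qed
  moreover have "p ` {..<n} \<subseteq> {..<n}"
    using p by auto
  ultimately have "bij_betw p {..<n} {..<n}"
    by (simp add: bij_betw_def endo_inj_surj)
  then show ?thesis
    using p that by blast
qed

text \<open>
  The remaining points of block \<open>i\<close> are mapped bijectively onto the remaining points of block
  \<open>p i\<close>. This extension property is the source of all elements of the stabiliser used below.
\<close>

lemma Stab_extension:
  assumes u: "u \<in> sym_inv_monoid X" and p: "bij_betw p {..<n} {..<n}"
    and blocks: "\<And>x y i. (x, y) \<in> u \<Longrightarrow> i < n \<Longrightarrow> x \<in> P i \<Longrightarrow> y \<in> P (p i)"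
    and compl: "\<And>i. i < n \<Longrightarrow> P i - Domain u \<approx> P (p i) - Range u"
  obtains s where "s \<in> Stab X n P" "u \<subseteq> s" "\<And>i. i < n \<Longrightarrow> s `` P i = P (p i)"
proof -
  have p_less: "p i < n" if "i < n" for i
    using p that bij_betw_apply by fastforce
  have p_inj: "i = j" if "i < n" "j < n" "p i = p j" for i j
    using p that by (auto simp: bij_betw_def inj_on_def)
  have p_surj: "\<exists>i<n. p i = j" if "j < n" for j
    using p that unfolding bij_betw_def by (metis imageE lessThan_iff)
  have fam1: "disjoint_family_on (\<lambda>i. P i - Domain u) {..<n}"
    using P_unique unfolding disjoint_family_on_def by blast
  have fam2: "disjoint_family_on (\<lambda>i. P (p i) - Range u) {..<n}"
    using P_unique p_less p_inj unfolding disjoint_family_on_def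
    by (smt (verit) Diff_iff disjoint_iff lessThan_iff)
  obtain v where v: "single_valued v" "single_valued (v\<inverse>)"
    "Domain v = (\<Union>i<n. P i - Domain u)" "Range v = (\<Union>i<n. P (p i) - Range u)"
    "v \<subseteq> (\<Union>i<n. (P i - Domain u) \<times> (P (p i) - Range u))"
    "\<forall>i\<in>{..<n}. v `` (P i - Domain u) = P (p i) - Range u"
    by (rule glue_eqpoll_families[OF fam1 fam2]) (simp add: compl)
  define s where "s = u \<union> v"
  have "s \<in> sym_inv_monoid X"
  proof -
    have "v \<subseteq> X \<times> X"
    proof clarify
      fix x y assume "(x, y) \<in> v"
      then obtain i where "i < n" "x \<in> P i" "y \<in> P (p i)"
        using v(5) by blast
      then show "x \<in> X \<and> y \<in> X"
        using P_subset p_less by blast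
    qed
    then have "s \<subseteq> X \<times> X"
      using u unfolding s_def sym_inv_monoid_def by blast
    moreover have "Domain u \<inter> Domain v = {}" "Range u \<inter> Range v = {}"
      using v(3,4) by auto
    then have "single_valued s" "single_valued (s\<inverse>)"
      using u v(1,2) unfolding s_def sym_inv_monoid_def single_valued_def by blast+
    ultimately show ?thesis
      by (simp add: sym_inv_monoid_def)
  qed
  moreover have "Domain s = X"
  proof -
    have "Domain u \<subseteq> X"
      using u unfolding sym_inv_monoid_def by blast
    then show ?thesis
      using v(3) X_eq unfolding s_def by blast
  qed
  moreover have "Range s = X"
  proof -
    have "Range u \<subseteq> X"
      using u unfolding sym_inv_monoid_def by blast
    moreover have "X = (\<Union>i<n. P (p i))"
    proof
      show "X \<subseteq> (\<Union>i<n. P (p i))"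
        using ex_block p_surj by fastforce
    qed (use p_less P_subset in blast)
    ultimately show ?thesis
      using v(4) unfolding s_def by blast
  qed
  moreover have im: "s `` P i = P (p i)" if i: "i < n" for i
  proof
    show "s `` P i \<subseteq> P (p i)"
    proof
      fix y assume "y \<in> s `` P i"
      then obtain x where x: "x \<in> P i" "(x, y) \<in> u \<or> (x, y) \<in> v"
        unfolding s_def by blast
      from this(2) show "y \<in> P (p i)"
      proof (elim disjE)
        assume "(x, y) \<in> v"
        then obtain j where "j < n" "x \<in> P j" "y \<in> P (p j)"
          using v(5) by blast
        then show ?thesis
          using P_unique i x(1) by blast
      qed (use blocks i x in blast)
    qed
    show "P (p i) \<subseteq> s `` P i"
    proof
      fix y assume y: "y \<in> P (p i)"
      show "y \<in> s `` P i"
      proof (cases "y \<in> Range u")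
        case True
        then obtain x where x: "(x, y) \<in> u" by blast
        then obtain j where j: "j < n" "x \<in> P j"
          using u ex_block unfolding sym_inv_monoid_def by blast
        then have "p j = p i"
          using blocks x y P_unique p_less i by blast
        then show ?thesis
          using p_inj i j x unfolding s_def by blast
      next
        case False
        then have "y \<in> v `` (P i - Domain u)"
          using y i v(6) by auto
        then show ?thesis
          unfolding s_def by blast
      qed
    qed
  qed
  ultimately have "s \<in> Stab X n P"
    using p_less unfolding Stab_def Sym_def by blast
  then show ?thesis
    using that im s_def by blast
qed

lemma ex_Stab_permuting_blocks:
  assumes "bij_betw p {..<n} {..<n}"
  obtains s where "s \<in> Stab X n P" "\<And>i. i < n \<Longrightarrow> s `` P i = P (p i)"
proof (rule Stab_extension[OF _ assms, of "{}"])
  fix i assume "i < n"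
  moreover from this have "p i < n"
    using assms bij_betw_apply by fastforce
  ultimately show "P i - Domain {} \<approx> P (p i) - Range {}"
    using P_large eqpoll_trans eqpoll_sym by (metis Diff_empty Domain_empty Range_empty)
qed (use that in \<open>auto simp: sym_inv_monoid_def\<close>)

text \<open>
  Halve each \<open>P i \<inter> B\<close>: one half has space for \<open>P i \<inter> C\<close>, and the other half stays outside the
  image of \<open>C\<close>. The last conclusion keeps the method applicable again after the next composition.
\<close>

lemma squeeze_into_large_set:
  assumes C: "C \<subseteq> X" "\<And>i. i < n \<Longrightarrow> P i - C \<approx> X"
    and B: "\<And>i. i < n \<Longrightarrow> P i \<inter> B \<approx> X"
  obtains s where "s \<in> Stab X n P" "\<And>i. i < n \<Longrightarrow> s `` P i = P i" "s `` C \<subseteq> B"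
    "\<And>i. i < n \<Longrightarrow> P i \<inter> B - s `` C \<approx> X"
proof -
  have "\<exists>E H. E \<approx> P i \<inter> C \<and> E \<union> H \<subseteq> P i \<inter> B \<and> E \<inter> H = {} \<and> H \<approx> X" if i: "i < n" for i
  proof -
    obtain G H where GH: "G \<union> H = P i \<inter> B" "G \<inter> H = {}" "G \<approx> X" "H \<approx> X"
      using large_halves[OF B[OF i]] by blast
    have "P i \<inter> C \<lesssim> G"
      using GH(3) C(1) by (meson Int_lower2 eqpoll_imp_lepoll eqpoll_sym lepoll_trans subset_imp_lepoll
          subset_trans)
    then obtain f where "inj_on f (P i \<inter> C)" "f ` (P i \<inter> C) \<subseteq> G"
      unfolding lepoll_def by blast
    then have "f ` (P i \<inter> C) \<approx> P i \<inter> C" "f ` (P i \<inter> C) \<union> H \<subseteq> P i \<inter> B" "f ` (P i \<inter> C) \<inter> H = {}"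
      using GH inj_on_image_eqpoll_self by blast+
    then show ?thesis
      using GH(4) by blast
  qed
  then obtain E H where EH: "\<And>i. i < n \<Longrightarrow> E i \<approx> P i \<inter> C \<and> E i \<union> H i \<subseteq> P i \<inter> B \<and> E i \<inter> H i = {} \<and> H i \<approx> X"
    by metis
  have "disjoint_family_on (\<lambda>i. P i \<inter> C) {..<n}"
    using P_unique unfolding disjoint_family_on_def by blast
  moreover have "disjoint_family_on E {..<n}"
    using P_unique EH unfolding disjoint_family_on_def by blast
  moreover have "\<And>i. i \<in> {..<n} \<Longrightarrow> P i \<inter> C \<approx> E i"
    using EH eqpoll_sym by blast
  ultimately obtain u where u: "single_valued u" "single_valued (u\<inverse>)"
    "Domain u = (\<Union>i<n. P i \<inter> C)" "Range u = (\<Union>i<n. E i)"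
    "u \<subseteq> (\<Union>i<n. (P i \<inter> C) \<times> E i)" "\<forall>i\<in>{..<n}. u `` (P i \<inter> C) = E i"
    by (rule glue_eqpoll_families)
  have EP: "E i \<subseteq> P i" "E i \<subseteq> B" "H i \<subseteq> P i" "H i \<subseteq> B" if "i < n" for i
    using EH[OF that] by blast+
  have HR: "H i \<inter> Range u = {}" if "i < n" for i
  proof -
    have "H i \<inter> E j = {}" if "j < n" for j
      using EH[OF \<open>i < n\<close>] EP(1)[OF that] EP(3)[OF \<open>i < n\<close>] P_unique[OF that \<open>i < n\<close>] by blast
    then show ?thesis
      using u(4) by blast
  qed
  have "u \<in> sym_inv_monoid X"
  proof -
    have "u \<subseteq> X \<times> X"
    proof clarify
      fix x y assume "(x, y) \<in> u"
      then obtain i where "i < n" "x \<in> P i" "y \<in> E i"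
        using u(5) by blast
      then show "x \<in> X \<and> y \<in> X"
        using P_subset EP(1) by blast
    qed
    then show ?thesis
      using u(1,2) by (simp add: sym_inv_monoid_def)
  qed
  moreover have "y \<in> P (id i)" if "(x, y) \<in> u" "i < n" "x \<in> P i" for x y i
  proof -
    obtain j where "j < n" "x \<in> P j" "y \<in> E j"
      using u(5) \<open>(x, y) \<in> u\<close> by blast
    then show ?thesis
      using that EP(1) P_unique by (metis id_apply subsetD)
  qed
  moreover have "P i - Domain u \<approx> P (id i) - Range u" if "i < n" for i
  proof -
    have "P i - Domain u \<approx> X"
      by (rule large_mono[OF C(2)[OF that]]) (use u(3) P_subset[OF that] in auto)
    moreover have "P i - Range u \<approx> X"
    proof (rule large_mono[of "H i"])
      show "H i \<approx> X"
        using EH[OF that] by blast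
      show "H i \<subseteq> P i - Range u"
        using EP(3)[OF that] HR[OF that] by blast
    qed (use P_subset[OF that] in blast)
    ultimately show ?thesis
      by (metis eqpoll_sym eqpoll_trans id_apply)
  qed
  ultimately obtain s where s: "s \<in> Stab X n P" "u \<subseteq> s" "\<And>i. i < n \<Longrightarrow> s `` P i = P (id i)"
    using Stab_extension[of u id] by (metis bij_betw_id)
  have sC: "s `` C \<subseteq> Range u"
  proof
    fix y assume "y \<in> s `` C"
    then obtain x where x: "x \<in> C" "(x, y) \<in> s" by blast
    then have "x \<in> Domain u"
      using u(3) C(1) X_eq by blast
    then obtain y' where "(x, y') \<in> u" by blast
    then show "y \<in> Range u"
      using s(2) x sym_inv_monoid_right_unique[OF Stab_sym_inv[OF s(1)]] by blast
  qed
  show ?thesis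
  proof (rule that)
    show "s \<in> Stab X n P" "\<And>i. i < n \<Longrightarrow> s `` P i = P i"
      using s by auto
    show "s `` C \<subseteq> B"
      using sC u(4) EP(2) by blast
    show "P i \<inter> B - s `` C \<approx> X" if i: "i < n" for i
    proof (rule large_mono[of "H i"])
      show "H i \<approx> X"
        using EH[OF i] by blast
      show "H i \<subseteq> P i \<inter> B - s `` C"
        using EP(3,4)[OF i] HR[OF i] sC by blast
    qed (use P_subset[OF i] in blast)
  qed
qed

lemma Stab_converse:
  assumes s: "s \<in> Stab X n P"
  shows "s\<inverse> \<in> Stab X n P"
proof -
  obtain p where p: "bij_betw p {..<n} {..<n}" "\<And>i. i < n \<Longrightarrow> s `` P i = P (p i)"
    using Stab_permutes_blocks[OF s] by blast
  have "\<exists>i<n. s\<inverse> `` P j = P i" if "j < n" for j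
  proof -
    obtain i where i: "i < n" "p i = j"
      using p(1) \<open>j < n\<close> unfolding bij_betw_def by (metis imageE lessThan_iff)
    have "s\<inverse> `` (s `` P i) = P i"
      using Stab_Domain[OF s] P_subset[OF i(1)] sym_inv_monoid_left_unique[OF Stab_sym_inv[OF s]]
      by blast
    then show ?thesis
      using i p(2)[OF i(1)] by auto
  qed
  then show ?thesis
    using Sym_converse s unfolding Stab_def by blast
qed

section \<open>Steering images into a single block\<close>

text \<open>
  Room in every block is what allows the image of \<open>t\<close> to be moved freely by the stabiliser.
\<close>

definition roomy :: "'a rel \<Rightarrow> bool" where
  "roomy t \<longleftrightarrow> t \<in> sym_inv_monoid X \<and> Domain t = X \<and> (\<forall>i<n. P i - Range t \<approx> X)"

lemma roomy_comp_Stab: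
  assumes t: "roomy t" and s: "s \<in> Stab X n P"
  shows "roomy (t O s)"
proof -
  have tS: "t \<in> sym_inv_monoid X" "Domain t = X"
    using t by (auto simp: roomy_def)
  obtain p where p: "bij_betw p {..<n} {..<n}" "\<And>i. i < n \<Longrightarrow> s `` P i = P (p i)"
    using Stab_permutes_blocks[OF s] by blast
  have "P j - Range (t O s) \<approx> X" if "j < n" for j
  proof -
    obtain i where i: "i < n" "p i = j"
      using p(1) \<open>j < n\<close> unfolding bij_betw_def by (metis imageE lessThan_iff)
    have "s `` (P i - Range t) \<approx> P i - Range t"
      using sym_inv_monoid_Image_eqpoll[OF Stab_sym_inv[OF s]] P_subset[OF i(1)] Stab_Domain[OF s]
      by blast
    then have "s `` (P i - Range t) \<approx> X"
      using t i(1) eqpoll_trans unfolding roomy_def by blast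
    moreover have "s `` (P i - Range t) \<subseteq> P j - Range (t O s)"
      using p(2)[OF i(1)] i(2) sym_inv_monoid_left_unique[OF Stab_sym_inv[OF s]] by blast
    ultimately show ?thesis
      using large_mono P_subset[OF \<open>j < n\<close>] by blast
  qed
  moreover have "Domain (t O s) = X"
    using tS sym_inv_monoid_in_carrier[OF tS(1)] Stab_Domain[OF s] by blast
  ultimately show ?thesis
    unfolding roomy_def using sym_inv_monoid_comp[OF tS(1) Stab_sym_inv[OF s]] by blast
qed

text \<open>
  Injecting every block into a half of itself gives a roomy element whose relation \<open>rho\<close> is the
  identity, so that it lies in \<open>A_semi X n P\<close> and in its inverse.
\<close>

lemma ex_roomy_preserving_blocks:
  obtains t where "roomy t" "\<forall>i<n. t `` P i \<subseteq> P i"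
proof -
  have "\<exists>A B. A \<union> B = P i \<and> A \<inter> B = {} \<and> A \<approx> X \<and> B \<approx> X" if i: "i < n" for i
    using large_halves[OF P_large[OF i]] by metis
  then obtain A B where AB:
    "\<And>i. i < n \<Longrightarrow> A i \<union> B i = P i \<and> A i \<inter> B i = {} \<and> A i \<approx> X \<and> B i \<approx> X"
    by metis
  have AP: "A i \<subseteq> P i" "B i \<subseteq> P i" if "i < n" for i
    using AB[OF that] by auto
  have "disjoint_family_on P {..<n}"
    using partition by (simp add: finite_partition_def)
  moreover have "disjoint_family_on A {..<n}"
    using P_unique AP(1) unfolding disjoint_family_on_def by blast
  moreover have "P i \<approx> A i" if "i \<in> {..<n}" for i
    using AB P_large that eqpoll_sym eqpoll_trans by (metis lessThan_iff)
  ultimately obtain t where t: "single_valued t" "single_valued (t\<inverse>)"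
    "Domain t = (\<Union>i<n. P i)" "Range t = (\<Union>i<n. A i)"
    "t \<subseteq> (\<Union>i<n. P i \<times> A i)" "\<forall>i\<in>{..<n}. t `` P i = A i"
    by (rule glue_eqpoll_families)
  have DR: "Domain t = X" "Range t \<subseteq> X"
    using t(3,4) X_eq AP(1) by blast+
  have "t \<subseteq> Domain t \<times> Range t"
    by auto
  then have "t \<subseteq> X \<times> X"
    using DR by fast
  then have "t \<in> sym_inv_monoid X"
    using t(1,2) by (simp add: sym_inv_monoid_def)
  moreover have "P i - Range t \<approx> X" if i: "i < n" for i
  proof -
    have "B i \<inter> A j = {}" if "j < n" for j
      using AB[OF i] AP[OF that] AP(2)[OF i] P_unique[OF that i] by blast
    then have "B i \<subseteq> P i - Range t"
      using AP(2)[OF i] t(4) by blast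
    then show ?thesis
      using large_mono AB[OF i] P_subset[OF i] by blast
  qed
  ultimately have "roomy t"
    using DR(1) unfolding roomy_def by blast
  then show ?thesis
    using that[of t] t(6) AP(1) by simp
qed

lemma rho_iff: "(i, j) \<in> rho X n P f \<longleftrightarrow> i < n \<and> j < n \<and> f `` P i \<inter> P j \<approx> X"
  by (simp add: rho_def)

lemma graph_of_bij_in_Sym:
  assumes "bij_betw c S S"
  shows "{(i, c i) | i. i \<in> S} \<in> Sym S"
  using assms unfolding Sym_def sym_inv_monoid_def single_valued_def bij_betw_def inj_on_def
  by blast

text \<open>
  Choose any function inside the relation. If the choice is a permutation, the relation contains
  a further pair \<open>(i, j)\<close>, and redirecting \<open>i\<close> to \<open>j\<close> destroys injectivity.
\<close>

lemma noninjective_selection: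
  assumes "h \<in> sym_inv_monoid X" and "h \<notin> A_semi X n P"
  obtains d where "\<And>i. i < n \<Longrightarrow> (i, d i) \<in> rho X n P h" "\<not> inj_on d {..<n}"
proof -
  let ?R = "rho X n P h"
  have dom: "Domain ?R = {..<n}" and nperm: "?R \<notin> Sym {..<n}"
    using assms by (auto simp: A_semi_def)
  then have "\<forall>i\<in>{..<n}. \<exists>j. (i, j) \<in> ?R"
    by blast
  then obtain c where c: "\<And>i. i < n \<Longrightarrow> (i, c i) \<in> ?R"
    by (metis lessThan_iff)
  show ?thesis
  proof (cases "inj_on c {..<n}")
    case False
    then show ?thesis
      using c that by blast
  next
    case True
    moreover have "c ` {..<n} \<subseteq> {..<n}"
      using c by (auto simp: rho_iff)
    ultimately have bij: "bij_betw c {..<n} {..<n}"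
      by (simp add: bij_betw_def endo_inj_surj)
    have "?R \<noteq> {(i, c i) | i. i \<in> {..<n}}"
      using graph_of_bij_in_Sym[OF bij] nperm by metis
    moreover have "{(i, c i) | i. i \<in> {..<n}} \<subseteq> ?R"
      using c by blast
    ultimately obtain i j where ij: "(i, j) \<in> ?R" "(i, j) \<notin> {(i, c i) | i. i \<in> {..<n}}"
      by fast
    then have lt: "i < n" "j < n" "j \<noteq> c i"
      by (auto simp: rho_iff)
    obtain k where k: "k < n" "c k = j"
      using bij lt(2) unfolding bij_betw_def by (metis imageE lessThan_iff)
    have "k \<noteq> i"
      using k lt by blast
    then have "\<not> inj_on (c(i := j)) {..<n}"
      using k lt(1) unfolding inj_on_def by (metis fun_upd_other fun_upd_same lessThan_iff)
    then show ?thesis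
      using that[of "c(i := j)"] c ij(1) by simp
  qed
qed

text \<open>
  Permute the blocks so that two members of \<open>F\<close> are moved to indices \<open>a \<noteq> b\<close> with
  \<open>d a = d b\<close>, squeeze the image into the points that \<open>h\<close> maps from block \<open>i\<close> to block \<open>d i\<close>,
  and apply \<open>h\<close>. The points that the squeezing leaves out keep the result roomy.
\<close>

lemma merge_blocks:
  assumes M: "subsemigroup M (sym_inv_monoid X)" "Stab X n P \<subseteq> M"
    and f: "f \<in> M" "roomy f" "F \<subseteq> {..<n}" "Range f \<subseteq> \<Union>(P ` F)" "2 \<le> card F"
    and h: "h \<in> M" "\<And>i. i < n \<Longrightarrow> (i, d i) \<in> rho X n P h" "\<not> inj_on d {..<n}"
  shows "\<exists>f' F'. f' \<in> M \<and> roomy f' \<and> F' \<subseteq> {..<n} \<and> Range f' \<subseteq> \<Union>(P ` F') \<and> card F' < card F"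
proof -
  have finF: "finite F"
    using f(3) finite_subset by blast
  obtain i j where ij: "i \<in> F" "j \<in> F" "i \<noteq> j"
    using f(5) by (metis card_le_Suc0_iff_eq finF not_less_eq_eq numeral_2_eq_2)
  obtain a b where ab: "a < n" "b < n" "a \<noteq> b" "d a = d b"
    using h(3) unfolding inj_on_def by auto
  obtain p where p: "bij_betw p {..<n} {..<n}" "p i = a" "p j = b"
    using ex_bij_betw_two_points[of i n j a b] ij f(3) ab by blast
  obtain w where w: "w \<in> Stab X n P" "\<And>i. i < n \<Longrightarrow> w `` P i = P (p i)"
    using ex_Stab_permuting_blocks[OF p(1)] by blast
  define G where "G = p ` F"
  have "G \<subseteq> p ` {..<n}"
    unfolding G_def using f(3) by blast
  then have G: "G \<subseteq> {..<n}" "a \<in> G" "b \<in> G" "card G \<le> card F"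
    using p ij finF card_image_le unfolding G_def bij_betw_def by auto
  define g where "g = f O w"
  have gM: "g \<in> M"
    using subsemigroup_comp[OF M(1) f(1)] w(1) M(2) unfolding g_def by blast
  have gr: "roomy g"
    using roomy_comp_Stab[OF f(2) w(1)] g_def by simp
  have gG: "Range g \<subseteq> \<Union>(P ` G)"
  proof
    fix z assume "z \<in> Range g"
    then obtain x y where "(x, y) \<in> f" "(y, z) \<in> w"
      unfolding g_def by blast
    moreover from this obtain k where "k \<in> F" "y \<in> P k"
      using f(4) by blast
    ultimately show "z \<in> \<Union>(P ` G)"
      using w(2)[of k] f(3) unfolding G_def by blast
  qed
  have d_less: "d i < n" if "i < n" for i
    using h(2)[OF that] by (simp add: rho_iff)
  have hS: "h \<in> sym_inv_monoid X"
    using h(1) M(1) unfolding subsemigroup_def by blast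
  have gS: "g \<in> sym_inv_monoid X" "Domain g = X" "\<And>i. i < n \<Longrightarrow> P i - Range g \<approx> X"
    using gr unfolding roomy_def by blast+
  \<comment> \<open>the points that \<open>h\<close> moves along \<open>d\<close>; every block contains a large set of them\<close>
  define B where "B = (\<Union>i<n. P i \<inter> h\<inverse> `` P (d i))"
  have PB: "P i \<inter> B = P i \<inter> h\<inverse> `` P (d i)" if "i < n" for i
    unfolding B_def using P_unique that by blast
  have "P i \<inter> B \<approx> X" if i: "i < n" for i
  proof -
    have "h `` (P i \<inter> h\<inverse> `` P (d i)) = h `` P i \<inter> P (d i)"
      using sym_inv_monoid_right_unique[OF hS] by blast
    then have "h `` (P i \<inter> B) \<approx> X"
      using h(2)[OF i] PB[OF i] by (simp add: rho_iff)
    moreover have "h `` (P i \<inter> B) \<approx> P i \<inter> B"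
      by (rule sym_inv_monoid_Image_eqpoll[OF hS]) (use PB[OF i] in blast)
    ultimately show ?thesis
      using eqpoll_sym eqpoll_trans by blast
  qed
  moreover have "Range g \<subseteq> X"
    using gS(1) unfolding sym_inv_monoid_def by blast
  ultimately obtain s where s: "s \<in> Stab X n P" "\<And>i. i < n \<Longrightarrow> s `` P i = P i" "s `` Range g \<subseteq> B"
    "\<And>i. i < n \<Longrightarrow> P i \<inter> B - s `` Range g \<approx> X"
    using squeeze_into_large_set[of "Range g" B] gS(3) by metis
  note sS = Stab_sym_inv[OF s(1)]
  define f' where "f' = g O s O h"
  define F' where "F' = d ` G"
  have f'_blocks: "\<exists>l. l \<in> G \<and> z \<in> P (d l)" if z: "z \<in> Range f'" for z
  proof -
    obtain x y' y where xyz: "(x, y') \<in> g" "(y', y) \<in> s" "(y, z) \<in> h"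
      using z unfolding f'_def by blast
    then obtain l where l: "l \<in> G" "y' \<in> P l"
      using gG by blast
    then have ln: "l < n"
      using G(1) by blast
    then have "y \<in> P l \<inter> B"
      using s(2)[OF ln] s(3) l xyz by blast
    then have "y \<in> P l \<inter> h\<inverse> `` P (d l)"
      using PB[OF ln] by blast
    then have "z \<in> P (d l)"
      using xyz(3) sym_inv_monoid_right_unique[OF hS] by blast
    then show ?thesis
      using l(1) by blast
  qed
  have "f' \<in> M"
    unfolding f'_def using subsemigroup_comp[OF M(1)] gM s(1) M(2) h(1) by blast
  moreover have "roomy f'"
    unfolding roomy_def
  proof (intro conjI allI impI)
    show "f' \<in> sym_inv_monoid X"
      unfolding f'_def using sym_inv_monoid_comp gS(1) sS hS by blast
    show "Domain f' = X"
    proof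
      show "X \<subseteq> Domain f'"
      proof
        fix x assume "x \<in> X"
        then obtain y where y: "(x, y) \<in> g"
          using gS(2) by blast
        then obtain z where z: "(y, z) \<in> s"
          using Stab_Domain[OF s(1)] sym_inv_monoid_in_carrier[OF gS(1)] by blast
        then have "z \<in> B"
          using s(3) y by blast
        then show "x \<in> Domain f'"
          using y z unfolding B_def f'_def by blast
      qed
    qed (use gS(2) in \<open>unfold f'_def, blast\<close>)
    fix k assume k: "k < n"
    show "P k - Range f' \<approx> X"
    proof (cases "\<exists>l<n. d l = k")
      case True
      then obtain l where l: "l < n" "d l = k"
        by blast
      \<comment> \<open>\<open>h\<close> carries the points of \<open>B\<close> left out by the squeezing to points of \<open>P k\<close> that are missed\<close>
      let ?D = "P l \<inter> B - s `` Range g"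
      have D: "?D \<subseteq> h\<inverse> `` P k"
        using PB[OF l(1)] l(2) by blast
      then have "h `` ?D \<approx> ?D"
        by (intro sym_inv_monoid_Image_eqpoll[OF hS]) blast
      then have "h `` ?D \<approx> X"
        using s(4)[OF l(1)] eqpoll_trans by blast
      moreover have "h `` ?D \<subseteq> P k - Range f'"
      proof
        fix z assume "z \<in> h `` ?D"
        then obtain y where y: "y \<in> ?D" "(y, z) \<in> h"
          by blast
        then have "z \<in> P k"
          using D sym_inv_monoid_right_unique[OF hS] by blast
        moreover have "z \<notin> Range f'"
        proof
          assume "z \<in> Range f'"
          then obtain y' where "y' \<in> s `` Range g" "(y', z) \<in> h"
            unfolding f'_def by blast
          then show False
            using y sym_inv_monoid_left_unique[OF hS] by blast
        qed
        ultimately show "z \<in> P k - Range f'"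
          by blast
      qed
      ultimately show ?thesis
        using large_mono P_subset[OF k] by blast
    next
      case False
      have "P k \<inter> Range f' = {}"
      proof (rule ccontr)
        assume "P k \<inter> Range f' \<noteq> {}"
        then obtain z l where "z \<in> P k" "l \<in> G" "z \<in> P (d l)"
          using f'_blocks by blast
        then show False
          using False k d_less G(1) P_unique by (metis lessThan_iff subsetD)
      qed
      then show ?thesis
        using P_large[OF k] by (simp add: Diff_triv)
    qed
  qed
  moreover have "F' \<subseteq> {..<n}"
    unfolding F'_def using d_less G(1) by auto
  moreover have "Range f' \<subseteq> \<Union>(P ` F')"
    unfolding F'_def using f'_blocks by blast
  moreover have "card F' < card F"
  proof -
    have finG: "finite G"
      using G(1) finite_subset by blast
    have "\<not> inj_on d G"
      using G(2,3) ab unfolding inj_on_def by blast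
    then have "card F' \<noteq> card G"
      unfolding F'_def using eq_card_imp_inj_on[OF finG] by blast
    moreover have "card F' \<le> card G"
      unfolding F'_def using card_image_le[OF finG] by blast
    ultimately show ?thesis
      using G(4) by linarith
  qed
  ultimately show ?thesis
    by blast
qed

text \<open>
  Take a roomy element of \<open>M\<close> whose image is covered by as few blocks as possible. By
  \<open>merge_blocks\<close> that number is less than two.
\<close>

lemma ex_roomy_into_one_block:
  assumes M: "subsemigroup M (sym_inv_monoid X)" "Stab X n P \<subseteq> M"
    and t: "t \<in> M" "roomy t" and nA: "\<not> M \<subseteq> A_semi X n P"
  obtains f k where "f \<in> M" "roomy f" "k < n" "Range f \<subseteq> P k"
proof -
  obtain h where h: "h \<in> M" "h \<notin> A_semi X n P"
    using nA by blast
  then have "h \<in> sym_inv_monoid X"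
    using M(1) unfolding subsemigroup_def by blast
  then obtain d where d: "\<And>i. i < n \<Longrightarrow> (i, d i) \<in> rho X n P h" "\<not> inj_on d {..<n}"
    using noninjective_selection h(2) by blast
  define Q where "Q m \<longleftrightarrow> (\<exists>f F. f \<in> M \<and> roomy f \<and> F \<subseteq> {..<n} \<and> Range f \<subseteq> \<Union>(P ` F) \<and> card F = m)"
    for m
  have "Range t \<subseteq> \<Union>(P ` {..<n})"
    using t(2) X_eq unfolding roomy_def sym_inv_monoid_def by blast
  then have "Q n"
    unfolding Q_def using t by (intro exI[of _ t] exI[of _ "{..<n}"]) auto
  then have Q: "Q (LEAST m. Q m)"
    by (rule LeastI)
  then obtain f F where f: "f \<in> M" "roomy f" "F \<subseteq> {..<n}" "Range f \<subseteq> \<Union>(P ` F)" "card F = (LEAST m. Q m)"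
    unfolding Q_def by blast
  have "\<not> 2 \<le> card F"
  proof
    assume "2 \<le> card F"
    then obtain f' F' where "f' \<in> M" "roomy f'" "F' \<subseteq> {..<n}" "Range f' \<subseteq> \<Union>(P ` F')" "card F' < card F"
      using merge_blocks[OF M f(1-4) _ h(1) d] by blast
    then have "Q (card F')" "card F' < (LEAST m. Q m)"
      unfolding Q_def f(5)[unfolded Q_def] by blast+
    then show False
      using not_less_Least by blast
  qed
  moreover have "card F \<noteq> 0"
  proof
    assume "card F = 0"
    then have "F = {}"
      using f(3) finite_subset by fastforce
    then have "Domain f = {}"
      using f(4) by blast
    then show False
      using f(2) infinite_X unfolding roomy_def by simp
  qed
  ultimately have "card F = 1"
    by linarith
  then obtain k where "F = {k}"
    using card_1_singletonE by blast
  then show ?thesis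
    using that[of f k] f by simp
qed

text \<open>
  The element \<open>s\<close> has to extend \<open>f\<inverse> O q O g\<close>, which maps the image of \<open>f\<close>, inside block \<open>k\<close>,
  onto the image of \<open>g\<close>, inside block \<open>l\<close>.
\<close>

lemma Sym_factors_through_one_block:
  assumes f: "roomy f" "k < n" "Range f \<subseteq> P k" and g: "roomy g" "l < n" "Range g \<subseteq> P l"
    and q: "q \<in> Sym X"
  obtains s where "s \<in> Stab X n P" "f O s O g\<inverse> = q"
proof -
  have fS: "f \<in> sym_inv_monoid X" "Domain f = X" "\<And>i. i < n \<Longrightarrow> P i - Range f \<approx> X"
    and gS: "g \<in> sym_inv_monoid X" "Domain g = X" "\<And>i. i < n \<Longrightarrow> P i - Range g \<approx> X"
    using f(1) g(1) unfolding roomy_def by blast+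
  have qS: "q \<in> sym_inv_monoid X" "Domain q = X" "Range q = X"
    using q by (auto simp: Sym_def)
  obtain p where p: "bij_betw p {..<n} {..<n}" "p k = l"
    using ex_bij_betw_point[OF n_ge_2 f(2) g(2)] by blast
  define u where "u = f\<inverse> O q O g"
  have "u \<in> sym_inv_monoid X"
    unfolding u_def by (intro sym_inv_monoid_comp sym_inv_monoid_converse fS gS qS)
  moreover have "y \<in> P (p i)" if "(x, y) \<in> u" "i < n" "x \<in> P i" for x y i
  proof -
    have "x \<in> P k" "y \<in> P l"
      using that(1) f(3) g(3) unfolding u_def by blast+
    then show ?thesis
      using that P_unique f(2) p(2) by metis
  qed
  moreover have "P i - Domain u \<approx> P (p i) - Range u" if i: "i < n" for i
  proof -
    have pi: "p i < n"
      using p(1) i bij_betw_apply by fastforce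
    have "P i - Domain u \<approx> X"
      by (rule large_mono[OF fS(3)[OF i]]) (use P_subset[OF i] in \<open>auto simp: u_def\<close>)
    moreover have "P (p i) - Range u \<approx> X"
      by (rule large_mono[OF gS(3)[OF pi]]) (use P_subset[OF pi] in \<open>auto simp: u_def\<close>)
    ultimately show ?thesis
      using eqpoll_sym eqpoll_trans by blast
  qed
  ultimately obtain s where s: "s \<in> Stab X n P" "u \<subseteq> s"
    using Stab_extension[of u p] p(1) by metis
  note sS = Stab_sym_inv[OF s(1)]
  have qsub: "q \<subseteq> f O s O g\<inverse>"
  proof clarify
    fix x z assume xz: "(x, z) \<in> q"
    then obtain y w where yw: "(x, y) \<in> f" "(z, w) \<in> g"
      using fS(2) gS(2) sym_inv_monoid_in_carrier[OF qS(1)] by blast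
    then have "(y, w) \<in> s"
      using xz s(2) unfolding u_def by blast
    then show "(x, z) \<in> f O s O g\<inverse>"
      using yw by blast
  qed
  have cS: "f O s O g\<inverse> \<in> sym_inv_monoid X"
    by (intro sym_inv_monoid_comp sym_inv_monoid_converse fS gS sS)
  have "f O s O g\<inverse> \<subseteq> q"
  proof
    fix e assume e: "e \<in> f O s O g\<inverse>"
    obtain x z where xz: "e = (x, z)"
      by (cases e)
    then have "x \<in> Domain q"
      using e cS qS(2) sym_inv_monoid_in_carrier[OF cS] by blast
    then obtain z' where z': "(x, z') \<in> q"
      by blast
    then have "z' = z"
      using sym_inv_monoid_right_unique[OF cS] qsub e xz by blast
    then show "e \<in> q"
      using z' xz by blast
  qed
  then show ?thesis
    using that s(1) qsub by blast
qed

section \<open>The sizes of the complements of images\<close>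

text \<open>
  When \<open>A\<close> fills almost all of its block there may be no way to move it into \<open>B\<close> as a whole; so
  only a part of the same cardinality, with large complement, is moved.
\<close>

lemma Stab_moving_into:
  assumes i: "i < n" "A \<subseteq> P i" and l: "l < n" "B \<subseteq> P l" "B \<approx> X"
  obtains w where "w \<in> Stab X n P" "A \<lesssim> w `` A \<inter> B"
proof -
  have "infinite (P i)"
    using P_large[OF i(1)] infinite_X eqpoll_finite_iff by blast
  then obtain A' where A': "A' \<subseteq> A" "A' \<approx> A" "P i - A' \<approx> P i"
    using i(2) by (rule eqpoll_subset_with_large_complement)
  obtain B1 B2 where B12: "B1 \<union> B2 = B" "B1 \<inter> B2 = {}" "B1 \<approx> X" "B2 \<approx> X"
    using large_halves[OF l(3)] by blast
  have "A' \<subseteq> X"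
    using A'(1) i P_subset by blast
  then have "A' \<lesssim> B1"
    using B12(3) by (meson lepoll_trans2 eqpoll_sym subset_imp_lepoll)
  then obtain g where g: "inj_on g A'" "g ` A' \<subseteq> B1"
    unfolding lepoll_def by blast
  define u where "u = (\<lambda>x. (x, g x)) ` A'"
  have Du: "Domain u = A'" and Ru: "Range u = g ` A'"
    unfolding u_def by auto
  have Ru_sub: "Range u \<subseteq> B1" "B1 \<subseteq> P l" "B2 \<subseteq> P l"
    using Ru g(2) B12(1) l(2) by auto
  obtain p where p: "bij_betw p {..<n} {..<n}" "p i = l"
    using ex_bij_betw_point[OF n_ge_2 i(1) l(1)] by blast
  have "u \<in> sym_inv_monoid X"
  proof -
    have "u \<subseteq> A' \<times> P l"
      unfolding u_def using g(2) Ru_sub(2) by auto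
    then have "u \<subseteq> X \<times> X"
      using \<open>A' \<subseteq> X\<close> P_subset[OF l(1)] by blast
    moreover have "single_valued u" "single_valued (u\<inverse>)"
      using g(1) unfolding u_def single_valued_def inj_on_def by auto
    ultimately show ?thesis
      by (simp add: sym_inv_monoid_def)
  qed
  moreover have "y \<in> P (p k)" if "(x, y) \<in> u" "k < n" "x \<in> P k" for x y k
  proof -
    have "x \<in> P i" "y \<in> P l"
      using that(1) Du Ru_sub A'(1) i(2) by blast+
    then show ?thesis
      using that P_unique i(1) p(2) by metis
  qed
  moreover have "P k - Domain u \<approx> P (p k) - Range u" if k: "k < n" for k
  proof -
    have pk: "p k < n"
      using p(1) k bij_betw_apply by fastforce
    have "P k - A' \<approx> X"
    proof (cases "k = i")
      case True
      then show ?thesis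
        using A'(3) P_large[OF i(1)] eqpoll_trans by blast
    next
      case False
      then have "P k \<inter> A' = {}"
        using A'(1) i k P_unique by blast
      then show ?thesis
        using P_large[OF k] by (simp add: Diff_triv)
    qed
    moreover have "P (p k) - Range u \<approx> X"
    proof (cases "p k = l")
      case True
      have "B2 \<subseteq> P l - Range u"
        using Ru_sub B12(2) by blast
      then show ?thesis
        using True large_mono[OF B12(4)] P_subset[OF l(1)] by blast
    next
      case False
      then have "P (p k) \<inter> Range u = {}"
        using Ru_sub l(1) pk P_unique by blast
      then show ?thesis
        using P_large[OF pk] by (simp add: Diff_triv)
    qed
    ultimately show ?thesis
      using Du eqpoll_sym eqpoll_trans by metis
  qed
  ultimately obtain w where w: "w \<in> Stab X n P" "u \<subseteq> w"
    using Stab_extension[of u p] p(1) by metis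
  have "A \<lesssim> g ` A'"
    using A'(2) inj_on_image_eqpoll_self[OF g(1)] eqpoll_sym eqpoll_trans eqpoll_imp_lepoll by metis
  moreover have "g ` A' \<subseteq> w `` A \<inter> B"
    using w(2) A'(1) g(2) B12(1) unfolding u_def by blast
  ultimately have "A \<lesssim> w `` A \<inter> B"
    using lepoll_trans[OF _ subset_imp_lepoll] by blast
  then show ?thesis
    using that[OF w(1)] by blast
qed

text \<open>
  In \<open>u O w O t\<close> a point missed by \<open>u\<close> becomes a new missed point, namely its image under
  \<open>w O t\<close>, in addition to those missed by \<open>t\<close>. The element \<open>w\<close> of the stabiliser is chosen so that
  \<open>P k\<close> receives as many new missed points as \<open>u\<close> misses in \<open>P i\<close>. This needs a block from which
  \<open>t\<close> maps many points into \<open>P k\<close>; if there is none, \<open>t\<close> already misses a large part of \<open>P k\<close>.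
\<close>

lemma spread_defect_step:
  assumes M: "subsemigroup M (sym_inv_monoid X)" "Stab X n P \<subseteq> M"
    and u: "u \<in> M" "Domain u = X" and t: "t \<in> M" "Domain t = X"
    and i: "i < n" and k: "k < n" and Y: "Y \<subseteq> X" "Y \<lesssim> P k - Range t"
  shows "\<exists>t'\<in>M. Domain t' = X \<and> Range t' \<subseteq> Range t \<and> Y \<union> (P i - Range u) \<lesssim> P k - Range t'"
proof (cases "P k \<inter> Range t \<approx> X")
  case False
  have "(P k \<inter> Range t) \<union> (P k - Range t) \<approx> X"
    using P_large[OF k] by (simp add: Int_Diff_Un)
  then have "P k - Range t \<approx> X"
    using infinite_Un_eqpoll_cases[OF infinite_X] False by blast
  moreover have "Y \<union> (P i - Range u) \<subseteq> X"
    using Y(1) P_subset[OF i] by blast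
  ultimately have "Y \<union> (P i - Range u) \<lesssim> P k - Range t"
    by (meson lepoll_trans2 eqpoll_sym subset_imp_lepoll)
  then show ?thesis
    using t by blast
next
  case True
  have tS: "t \<in> sym_inv_monoid X" and uS: "u \<in> sym_inv_monoid X"
    using t(1) u(1) M(1) unfolding subsemigroup_def by blast+
  have "t `` (t\<inverse> `` P k) = P k \<inter> Range t"
    using sym_inv_monoid_right_unique[OF tS] by blast
  then have "t\<inverse> `` P k \<approx> X"
    using sym_inv_monoid_Image_eqpoll[OF tS, of "t\<inverse> `` P k"] True eqpoll_sym eqpoll_trans
    by (metis Domain_converse converse_converse Range.intros subsetI Image_iff)
  moreover have "t\<inverse> `` P k \<subseteq> X"
    using t(2) by blast
  ultimately obtain l where l: "l < n" "P l \<inter> t\<inverse> `` P k \<approx> X"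
    using ex_large_block by blast
  let ?A = "P i - Range u" and ?B = "P l \<inter> t\<inverse> `` P k"
  obtain w where w: "w \<in> Stab X n P" "?A \<lesssim> w `` ?A \<inter> ?B"
    using Stab_moving_into[of i ?A l ?B] i l by blast
  define t' where "t' = u O w O t"
  have "t' \<in> M"
    unfolding t'_def using subsemigroup_comp[OF M(1)] u(1) w(1) M(2) t(1) by blast
  moreover have "Domain t' = X"
  proof
    show "X \<subseteq> Domain t'"
    proof
      fix x assume "x \<in> X"
      then obtain y where y: "(x, y) \<in> u"
        using u(2) by blast
      then obtain z where z: "(y, z) \<in> w"
        using Stab_Domain[OF w(1)] sym_inv_monoid_in_carrier[OF uS] by blast
      then have "z \<in> Domain t"
        using t(2) sym_inv_monoid_in_carrier[OF Stab_sym_inv[OF w(1)]] by blast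
      then show "x \<in> Domain t'"
        using y z unfolding t'_def by blast
    qed
  qed (use u(2) in \<open>unfold t'_def, blast\<close>)
  moreover have "Range t' \<subseteq> Range t"
    unfolding t'_def by blast
  moreover have "Y \<union> ?A \<lesssim> P k - Range t'"
  proof -
    let ?W = "w `` ?A \<inter> ?B"
    have "t `` ?W \<approx> ?W"
      by (rule sym_inv_monoid_Image_eqpoll[OF tS]) blast
    then have "?A \<lesssim> t `` ?W"
      using w(2) by (meson eqpoll_sym lepoll_trans2)
    moreover have "disjnt (P k - Range t) (t `` ?W)"
      unfolding disjnt_def by blast
    ultimately have "Y \<union> ?A \<lesssim> (P k - Range t) \<union> t `` ?W"
      using Un_lepoll_mono[OF Y(2)] by blast
    moreover have "t `` ?W \<subseteq> P k - Range t'"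
    proof
      fix z assume "z \<in> t `` ?W"
      then obtain y x where yx: "(y, z) \<in> t" "(x, y) \<in> w" "x \<notin> Range u" "y \<in> ?B"
        by blast
      have "z \<in> P k"
        using yx(1,4) sym_inv_monoid_right_unique[OF tS] by blast
      moreover have "z \<notin> Range t'"
      proof
        assume "z \<in> Range t'"
        then obtain x' y' where "x' \<in> Range u" "(x', y') \<in> w" "(y', z) \<in> t"
          unfolding t'_def by blast
        then show False
          using yx sym_inv_monoid_left_unique[OF tS]
            sym_inv_monoid_left_unique[OF Stab_sym_inv[OF w(1)]] by blast
      qed
      ultimately show "z \<in> P k - Range t'"
        by blast
    qed
    then have "(P k - Range t) \<union> t `` ?W \<subseteq> P k - Range t'"
      unfolding t'_def by blast
    ultimately show ?thesis
      using lepoll_trans subset_imp_lepoll by blast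
  qed
  ultimately show ?thesis
    by blast
qed

text \<open>
  The sets \<open>P i - Range u\<close> may all differ in size, and for finite complements no single one of
  them need be as large as \<open>X - Range u\<close>. Hence the sets are collected in every block one by one:
  the induction runs over the pairs \<open>(i, k)\<close> for which the missed points of \<open>u\<close> in block \<open>i\<close>
  have been copied to block \<open>k\<close>.
\<close>

lemma spread_defect:
  assumes M: "subsemigroup M (sym_inv_monoid X)" "Stab X n P \<subseteq> M"
    and u: "u \<in> M" "Domain u = X"
  obtains t where "t \<in> M" "Domain t = X" "\<And>k. k < n \<Longrightarrow> X - Range u \<lesssim> P k - Range t"
proof -
  let ?Y = "\<lambda>F k. \<Union>i\<in>{i. (i, k) \<in> F}. P i - Range u"
  have "\<exists>t\<in>M. Domain t = X \<and> (\<forall>k<n. ?Y F k \<lesssim> P k - Range t)"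
    if "finite F" "F \<subseteq> {..<n} \<times> {..<n}" for F
    using that
  proof (induction F)
    case empty
    then show ?case
      using Id_on_Stab M(2) by (intro bexI[of _ "Id_on X"]) auto
  next
    case (insert e F)
    obtain i k where e: "e = (i, k)" "i < n" "k < n"
      using insert.prems by auto
    obtain t where t: "t \<in> M" "Domain t = X" "\<And>k. k < n \<Longrightarrow> ?Y F k \<lesssim> P k - Range t"
      using insert by auto
    have "?Y F k \<subseteq> X"
      using insert.prems P_subset by fastforce
    then obtain t' where t': "t' \<in> M" "Domain t' = X" "Range t' \<subseteq> Range t"
      "?Y F k \<union> (P i - Range u) \<lesssim> P k - Range t'"
      using spread_defect_step[OF M u t(1,2) e(2,3)] t(3)[OF e(3)] by blast
    have "?Y (insert e F) m \<lesssim> P m - Range t'" if "m < n" for m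
    proof (cases "m = k")
      case True
      then have "?Y (insert e F) m = ?Y F k \<union> (P i - Range u)"
        using e(1) by auto
      then show ?thesis
        using t'(4) True by simp
    next
      case False
      then have "?Y (insert e F) m = ?Y F m"
        using e(1) by auto
      moreover have "P m - Range t \<lesssim> P m - Range t'"
        using t'(3) by (intro subset_imp_lepoll) blast
      ultimately show ?thesis
        using t(3)[OF that] lepoll_trans by metis
    qed
    then show ?case
      using t'(1,2) by blast
  qed
  from this[of "{..<n} \<times> {..<n}"] obtain t where t: "t \<in> M" "Domain t = X"
    "\<And>k. k < n \<Longrightarrow> ?Y ({..<n} \<times> {..<n}) k \<lesssim> P k - Range t"
    by auto
  have "?Y ({..<n} \<times> {..<n}) k = X - Range u" if "k < n" for k
    using that X_eq by auto
  then show ?thesis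
    using t that by metis
qed

text \<open>
  Sets are small if they inject into the complement of the image of some element of \<open>M\<close> with
  domain \<open>X\<close>. The small sets form an ideal that is invariant under injections, and \<open>X\<close> is small
  only if \<open>M\<close> has a roomy element, by \<open>spread_defect\<close>. The semigroup \<open>N\<close> consists of the elements
  whose image has a small complement whenever their domain has one.
\<close>

lemma no_roomy_imp_in_proper_subsemigroup:
  assumes M: "subsemigroup M (sym_inv_monoid X)" "Stab X n P \<subseteq> M"
    and no_roomy: "\<And>t. t \<in> M \<Longrightarrow> \<not> roomy t"
  obtains N where "subsemigroup N (sym_inv_monoid X)" "N \<noteq> sym_inv_monoid X" "M \<subseteq> N" "Sym X \<subseteq> N"
proof -
  define small where "small Y \<longleftrightarrow> (\<exists>u\<in>M. Domain u = X \<and> Y \<lesssim> X - Range u)" for Y :: "'a set"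
  have M_inv: "f \<in> sym_inv_monoid X" if "f \<in> M" for f
    using that M(1) unfolding subsemigroup_def by blast
  have small_lepoll: "small Z" if "small Y" "Z \<lesssim> Y" for Y Z
    using that lepoll_trans unfolding small_def by blast
  have small_subset: "small Z" if "small Y" "Z \<subseteq> Y" for Y Z
    using small_lepoll that subset_imp_lepoll by blast
  have small_empty: "small {}"
    using Id_on_Stab M(2) unfolding small_def by (intro bexI[of _ "Id_on X"]) auto
  have small_Un: "small (Y \<union> Z)" if Y: "small Y" and Z: "small Z" for Y Z
  proof -
    obtain u where u: "u \<in> M" "Domain u = X" "Y \<lesssim> X - Range u"
      using Y small_def by blast
    obtain v where v: "v \<in> M" "Domain v = X" "Z \<lesssim> X - Range v"
      using Z small_def by blast
    note vI = M_inv[OF v(1)]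
    have "v `` (X - Range u) \<approx> X - Range u"
      by (rule sym_inv_monoid_Image_eqpoll[OF vI]) (use v(2) in blast)
    then have "Y \<lesssim> v `` (X - Range u)"
      using u(3) by (meson eqpoll_sym lepoll_trans2)
    then have "Y \<union> Z \<lesssim> v `` (X - Range u) \<union> (X - Range v)"
      by (rule Un_lepoll_mono[OF _ v(3)]) (auto simp: disjnt_def)
    moreover have "v `` (X - Range u) \<union> (X - Range v) \<subseteq> X - Range (u O v)"
      using sym_inv_monoid_left_unique[OF vI] sym_inv_monoid_in_carrier[OF vI] by blast
    ultimately have "Y \<union> Z \<lesssim> X - Range (u O v)"
      using lepoll_trans subset_imp_lepoll by blast
    moreover have "Domain (u O v) = X"
      using u(2) v(2) sym_inv_monoid_in_carrier[OF M_inv[OF u(1)]] by blast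
    ultimately show ?thesis
      unfolding small_def using subsemigroup_comp[OF M(1) u(1) v(1)] by blast
  qed
  have not_small_X: "\<not> small X"
  proof
    assume "small X"
    then obtain u where u: "u \<in> M" "Domain u = X" "X \<lesssim> X - Range u"
      using small_def by blast
    obtain t where t: "t \<in> M" "Domain t = X" "\<And>k. k < n \<Longrightarrow> X - Range u \<lesssim> P k - Range t"
      using spread_defect[OF M u(1,2)] by blast
    have "P k - Range t \<approx> X" if "k < n" for k
      using large_lepoll lepoll_trans[OF u(3) t(3)[OF that]] P_subset[OF that] by blast
    then show False
      using no_roomy[OF t(1)] t(2) M_inv[OF t(1)] unfolding roomy_def by blast
  qed
  \<comment> \<open>Some \<open>t \<in> M\<close> with domain \<open>X\<close> misses, after a move by the stabiliser, the complement of the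
    domain of \<open>f\<close>. Then \<open>t\<close> followed by \<open>f\<close> has domain \<open>X\<close> and misses what \<open>f\<close> misses.\<close>
  have small_range: "small (X - Range f)" if f: "f \<in> M" "small (X - Domain f)" for f
  proof -
    note fI = M_inv[OF f(1)]
    obtain u where u: "u \<in> M" "Domain u = X" "X - Domain f \<lesssim> X - Range u"
      using f(2) small_def by blast
    obtain t where t: "t \<in> M" "Domain t = X" "\<And>k. k < n \<Longrightarrow> X - Range u \<lesssim> P k - Range t"
      using spread_defect[OF M u(1,2)] by blast
    note tI = M_inv[OF t(1)]
    have "\<exists>E. E \<subseteq> P i - Range t \<and> P i - Domain f \<approx> E" if i: "i < n" for i
    proof -
      have "P i - Domain f \<lesssim> X - Domain f"
        using P_subset[OF i] by (intro subset_imp_lepoll) blast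
      then have "P i - Domain f \<lesssim> P i - Range t"
        using u(3) t(3)[OF i] lepoll_trans by blast
      then obtain g where "inj_on g (P i - Domain f)" "g ` (P i - Domain f) \<subseteq> P i - Range t"
        unfolding lepoll_def by blast
      then show ?thesis
        using inj_on_image_eqpoll_self eqpoll_sym by metis
    qed
    then obtain E where E: "\<And>i. i < n \<Longrightarrow> E i \<subseteq> P i - Range t \<and> P i - Domain f \<approx> E i"
      by metis
    have EP: "E i \<subseteq> P i" if "i < n" for i
      using E[OF that] by blast
    have fam1: "disjoint_family_on (\<lambda>i. P i - Domain f) {..<n}"
      using P_unique unfolding disjoint_family_on_def by blast
    have fam2: "disjoint_family_on E {..<n}"
      using P_unique EP unfolding disjoint_family_on_def by blast
    obtain v where v: "single_valued v" "single_valued (v\<inverse>)"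
      "Domain v = (\<Union>i<n. P i - Domain f)" "Range v = (\<Union>i<n. E i)"
      "v \<subseteq> (\<Union>i<n. (P i - Domain f) \<times> E i)" "\<forall>i\<in>{..<n}. v `` (P i - Domain f) = E i"
      by (rule glue_eqpoll_families[OF fam1 fam2]) (use E in simp)
    have v_block: "\<exists>j<n. x \<in> P j \<and> y \<in> P j" if xy: "(x, y) \<in> v" for x y
      using v(5) xy EP by blast
    have "v \<in> sym_inv_monoid X"
    proof -
      have "v \<subseteq> X \<times> X"
        using v_block P_subset by fast
      then show ?thesis
        using v(1,2) by (simp add: sym_inv_monoid_def)
    qed
    moreover have "y \<in> P (id i)" if "(x, y) \<in> v" "i < n" "x \<in> P i" for x y i
      using v_block that P_unique by (metis id_apply)
    moreover have "P i - Domain v \<approx> P (id i) - Range v" if i: "i < n" for i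
    proof -
      \<comment> \<open>a large set is not small, so both complements that have to be matched are large\<close>
      have compl: "P i - D \<approx> X" if D: "D \<approx> P i - Domain f" "D \<subseteq> P i" for D
      proof -
        have "D \<lesssim> X - Domain f"
          using D(1) P_subset[OF i] by (meson Diff_mono lepoll_trans1 order_refl subset_imp_lepoll)
        then have "\<not> D \<approx> X"
          using not_small_X small_lepoll f(2) by (meson eqpoll_sym lepoll_trans1)
        moreover have "D \<union> (P i - D) \<approx> X"
          using D(2) P_large[OF i] by (simp add: Un_absorb1)
        ultimately show ?thesis
          using infinite_Un_eqpoll_cases[OF infinite_X] by blast
      qed
      have "P i - Domain v = P i - (P i - Domain f)"
        using v(3) i P_unique by blast
      moreover have "P i - Range v = P i - E i"
        using v(4) i EP P_unique by blast
      moreover have "P i - (P i - Domain f) \<approx> X"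
        by (rule compl) auto
      moreover have "P i - E i \<approx> X"
        by (rule compl) (use E[OF i] EP[OF i] eqpoll_sym in blast)+
      ultimately show ?thesis
        using eqpoll_sym eqpoll_trans by (metis id_apply)
    qed
    ultimately obtain s where s: "s \<in> Stab X n P" "v \<subseteq> s"
      using Stab_extension[of v id] by (metis bij_betw_id)
    note sI = Stab_sym_inv[OF s(1)]
    define t' where "t' = t O s\<inverse> O f"
    have "t' \<in> M"
      unfolding t'_def using subsemigroup_comp[OF M(1)] t(1) Stab_converse[OF s(1)] M(2) f(1) by blast
    moreover have "Domain t' = X"
    proof
      show "X \<subseteq> Domain t'"
      proof
        fix x assume "x \<in> X"
        then obtain y where y: "(x, y) \<in> t"
          using t(2) by blast
        then obtain z where z: "(z, y) \<in> s"
          using Stab_Range[OF s(1)] sym_inv_monoid_in_carrier[OF tI] by blast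
        have "z \<in> Domain f"
        proof (rule ccontr)
          assume "z \<notin> Domain f"
          moreover have "z \<in> X"
            using z sym_inv_monoid_in_carrier[OF sI] by blast
          ultimately have "z \<in> Domain v"
            using v(3) X_eq by blast
          then obtain y' where "(z, y') \<in> v"
            by blast
          then have "(z, y) \<in> v"
            using s(2) z sym_inv_monoid_right_unique[OF sI] by blast
          then obtain i where "i < n" "y \<in> E i"
            using v(5) by blast
          then show False
            using E y by blast
        qed
        then show "x \<in> Domain t'"
          using y z unfolding t'_def by blast
      qed
    qed (use t(2) in \<open>unfold t'_def, blast\<close>)
    moreover have "X - Range f \<subseteq> X - Range t'"
      unfolding t'_def by blast
    ultimately show ?thesis
      unfolding small_def using subset_imp_lepoll by blast
  qed
  define N where "N = {f \<in> sym_inv_monoid X. small (X - Domain f) \<longrightarrow> small (X - Range f)}"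
  have "f O g \<in> N" if fN: "f \<in> N" and gN: "g \<in> N" for f g
  proof -
    have fI: "f \<in> sym_inv_monoid X" and gI: "g \<in> sym_inv_monoid X"
      using fN gN by (auto simp: N_def)
    \<comment> \<open>The complement of the domain of \<open>g\<close> is covered by the complement of the image of \<open>f\<close> and by
      points that \<open>f\<close> pulls back into the complement of the domain of \<open>f O g\<close>.\<close>
    have "small (X - Range (f O g))" if sm: "small (X - Domain (f O g))"
    proof -
      have "X - Domain f \<subseteq> X - Domain (f O g)"
        by blast
      then have "small (X - Domain f)"
        using sm small_subset by blast
      then have f_range: "small (X - Range f)"
        using fN by (simp add: N_def)
      have "f\<inverse> `` (Range f - Domain g) \<approx> Range f - Domain g"
        by (rule sym_inv_monoid_Image_eqpoll[OF sym_inv_monoid_converse[OF fI]]) blast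
      moreover have "f\<inverse> `` (Range f - Domain g) \<subseteq> X - Domain (f O g)"
        using sym_inv_monoid_right_unique[OF fI] sym_inv_monoid_in_carrier[OF fI] by blast
      ultimately have "small (Range f - Domain g)"
        using small_lepoll small_subset sm eqpoll_sym eqpoll_imp_lepoll by metis
      then have "small ((X - Range f) \<union> (Range f - Domain g))"
        using small_Un f_range by blast
      then have "small (X - Domain g)"
        by (rule small_subset) blast
      then have "small (X - Range g)"
        using gN by (simp add: N_def)
      moreover have "small (g `` (X - Range f))"
        using small_lepoll[OF f_range] sym_inv_monoid_Image_lepoll[OF gI] by blast
      ultimately have "small ((X - Range g) \<union> g `` (X - Range f))"
        using small_Un by blast
      moreover have "X - Range (f O g) \<subseteq> (X - Range g) \<union> g `` (X - Range f)"
        using sym_inv_monoid_in_carrier[OF gI] by blast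
      ultimately show ?thesis
        using small_subset by blast
    qed
    then show ?thesis
      using sym_inv_monoid_comp[OF fI gI] by (simp add: N_def)
  qed
  then have "subsemigroup N (sym_inv_monoid X)"
    unfolding subsemigroup_def by (auto simp: N_def)
  moreover have "M \<subseteq> N"
    using small_range M_inv by (auto simp: N_def)
  moreover have "Sym X \<subseteq> N"
    using small_empty by (auto simp: N_def Sym_def)
  moreover have "N \<noteq> sym_inv_monoid X"
  proof -
    obtain e where e: "roomy e" "\<forall>i<n. e `` P i \<subseteq> P i"
      by (rule ex_roomy_preserving_blocks)
    have eI: "e \<in> sym_inv_monoid X" "Domain e = X"
      using e(1) unfolding roomy_def by blast+
    have n0: "0 < n"
      using n_ge_2 by simp
    have "P 0 - Range e \<approx> X"
      using e(1) n0 unfolding roomy_def by blast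
    then have "X - Range e \<approx> X"
      by (rule large_mono) (use P_subset[OF n0] in blast)+
    then have "\<not> small (X - Range e)"
      using not_small_X small_lepoll eqpoll_sym eqpoll_imp_lepoll by blast
    then have "e \<notin> N"
      using eI small_empty by (simp add: N_def)
    then show ?thesis
      using eI by blast
  qed
  ultimately show ?thesis
    by (intro that)
qed

section \<open>The semigroup A and its inverse\<close>

lemma rho_converse:
  assumes f: "f \<in> sym_inv_monoid X"
  shows "rho X n P (f\<inverse>) = (rho X n P f)\<inverse>"
proof -
  have "f\<inverse> `` P i \<inter> P j \<approx> f `` P j \<inter> P i" for i j
  proof -
    have "f `` (f\<inverse> `` P i \<inter> P j) = f `` P j \<inter> P i"
      using sym_inv_monoid_right_unique[OF f] by blast
    moreover have "f `` (f\<inverse> `` P i \<inter> P j) \<approx> f\<inverse> `` P i \<inter> P j"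
      by (rule sym_inv_monoid_Image_eqpoll[OF f]) blast
    ultimately show ?thesis
      by (simp add: eqpoll_sym)
  qed
  then have "f\<inverse> `` P i \<inter> P j \<approx> X \<longleftrightarrow> f `` P j \<inter> P i \<approx> X" for i j
    using eqpoll_sym eqpoll_trans by blast
  then show ?thesis
    by (auto simp: rho_def)
qed

text \<open>
  The points of block \<open>i\<close> that \<open>f O g\<close> sends to block \<open>k\<close> pass through finitely many blocks, so
  a large set of them passes through the same block.
\<close>

lemma rho_comp_subset:
  assumes f: "f \<in> sym_inv_monoid X" and g: "g \<in> sym_inv_monoid X"
  shows "rho X n P (f O g) \<subseteq> rho X n P f O rho X n P g"
proof clarify
  fix i k assume "(i, k) \<in> rho X n P (f O g)"
  then have ik: "i < n" "k < n" "(f O g) `` P i \<inter> P k \<approx> X"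
    by (auto simp: rho_iff)
  let ?Y = "f `` P i \<inter> g\<inverse> `` P k"
  have "g `` ?Y = (f O g) `` P i \<inter> P k"
    using sym_inv_monoid_right_unique[OF g] by blast
  moreover have "g `` ?Y \<approx> ?Y"
    by (rule sym_inv_monoid_Image_eqpoll[OF g]) blast
  ultimately have "?Y \<approx> X"
    using ik(3) eqpoll_sym eqpoll_trans by metis
  moreover have "?Y \<subseteq> X"
    using sym_inv_monoid_in_carrier[OF f] by blast
  ultimately obtain j where j: "j < n" "P j \<inter> ?Y \<approx> X"
    using ex_large_block by blast
  have "f `` P i \<inter> P j \<approx> X"
    by (rule large_mono[OF j(2)]) (use P_subset[OF j(1)] in blast)+
  moreover have "g `` P j \<inter> P k \<approx> X"
  proof -
    have "g `` (P j \<inter> ?Y) \<approx> P j \<inter> ?Y"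
      by (rule sym_inv_monoid_Image_eqpoll[OF g]) blast
    then have "g `` (P j \<inter> ?Y) \<approx> X"
      using j(2) eqpoll_trans by blast
    moreover have "g `` (P j \<inter> ?Y) \<subseteq> g `` P j \<inter> P k"
      using sym_inv_monoid_right_unique[OF g] by blast
    ultimately show ?thesis
      by (rule large_mono) (use P_subset[OF ik(2)] in blast)
  qed
  ultimately show "(i, k) \<in> rho X n P f O rho X n P g"
    using ik j(1) rho_iff by blast
qed

lemma rho_in_square: "rho X n P f \<subseteq> {..<n} \<times> {..<n}"
  by (auto simp: rho_def)

lemma A_semi_subsemigroup: "subsemigroup (A_semi X n P) (sym_inv_monoid X)"
  unfolding subsemigroup_def
proof (intro conjI ballI)
  fix f g assume fA: "f \<in> A_semi X n P" and gA: "g \<in> A_semi X n P"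
  let ?f = "rho X n P f" and ?g = "rho X n P g" and ?fg = "rho X n P (f O g)"
  have fI: "f \<in> sym_inv_monoid X" and gI: "g \<in> sym_inv_monoid X"
    using fA gA by (auto simp: A_semi_def)
  note sub = rho_comp_subset[OF fI gI]
  have "?fg \<in> Sym {..<n}" if dom: "Domain ?fg = {..<n}"
  proof -
    have "Domain ?f = {..<n}"
      using sub dom rho_in_square by blast
    then have f: "?f \<in> Sym {..<n}"
      using fA by (simp add: A_semi_def)
    have "Domain ?g = {..<n}"
    proof
      show "{..<n} \<subseteq> Domain ?g"
      proof
        fix j assume "j \<in> {..<n}"
        then obtain i where ij: "(i, j) \<in> ?f"
          using f unfolding Sym_def by blast
        then have "i \<in> Domain ?fg"
          using dom rho_in_square by blast
        then obtain j' where "(i, j') \<in> ?f" "j' \<in> Domain ?g"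
          using sub by blast
        then show "j \<in> Domain ?g"
          using f ij unfolding Sym_def sym_inv_monoid_def single_valued_def by blast
      qed
    qed (use rho_in_square in blast)
    then have "?g \<in> Sym {..<n}"
      using gA by (simp add: A_semi_def)
    then have "?f O ?g \<in> Sym {..<n}"
      using f Sym_comp by blast
    then show ?thesis
      using Sym_subset_imp_eq[OF _ sub dom] by metis
  qed
  then show "f O g \<in> A_semi X n P"
    using sym_inv_monoid_comp[OF fI gI] by (auto simp: A_semi_def)
qed (auto simp: A_semi_def)

lemma inverses_A_semi:
  "inverses (A_semi X n P) = {f \<in> sym_inv_monoid X.
     rho X n P f \<in> Sym {..<n} \<or> Range (rho X n P f) \<noteq> {..<n}}"
proof -
  have "f\<inverse> \<in> A_semi X n P \<longleftrightarrow> f \<in> sym_inv_monoid X \<and>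
      (rho X n P f \<in> Sym {..<n} \<or> Range (rho X n P f) \<noteq> {..<n})" for f
  proof (cases "f \<in> sym_inv_monoid X")
    case True
    have "(rho X n P f)\<inverse> \<in> Sym {..<n} \<longleftrightarrow> rho X n P f \<in> Sym {..<n}"
      using Sym_converse converse_converse by metis
    then show ?thesis
      using True sym_inv_monoid_converse[OF True] rho_converse[OF True] by (simp add: A_semi_def)
  next
    case False
    then have "f\<inverse> \<notin> sym_inv_monoid X"
      using sym_inv_monoid_converse converse_converse by metis
    then show ?thesis
      using False by (simp add: A_semi_def)
  qed
  then show ?thesis
    unfolding set_eq_iff inverses_iff mem_Collect_eq by blast
qed

lemma Stab_subset_A_semi: "Stab X n P \<subseteq> A_semi X n P"
proof
  fix s assume s: "s \<in> Stab X n P"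
  then obtain p where p: "bij_betw p {..<n} {..<n}" "\<And>i. i < n \<Longrightarrow> s `` P i = P (p i)"
    using Stab_permutes_blocks by blast
  have p_less: "p i < n" if "i < n" for i
    using p(1) that bij_betw_apply by fastforce
  have "(i, j) \<in> rho X n P s \<longleftrightarrow> i < n \<and> j = p i" for i j
  proof
    assume "(i, j) \<in> rho X n P s"
    then have ij: "i < n" "j < n" "P (p i) \<inter> P j \<approx> X"
      using p(2) by (auto simp: rho_iff)
    then have "P (p i) \<inter> P j \<noteq> {}"
      using large_nonempty by blast
    then show "i < n \<and> j = p i"
      using ij P_unique p_less by blast
  next
    assume "i < n \<and> j = p i"
    then show "(i, j) \<in> rho X n P s"
      using p(2) p_less P_large by (simp add: rho_iff)
  qed
  then have "rho X n P s = {(i, p i) | i. i \<in> {..<n}}"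
    by auto
  then have "rho X n P s \<in> Sym {..<n}"
    using graph_of_bij_in_Sym[OF p(1)] by simp
  then show "s \<in> A_semi X n P"
    using Stab_sym_inv[OF s] by (simp add: A_semi_def)
qed

lemma inverses_Stab: "inverses (Stab X n P) = Stab X n P"
proof (rule set_eqI)
  fix f show "f \<in> inverses (Stab X n P) \<longleftrightarrow> f \<in> Stab X n P"
    using Stab_converse[of f] Stab_converse[of "f\<inverse>"] by (auto simp: inverses_iff)
qed

lemma Stab_subset_inverses: "Stab X n P \<subseteq> M \<Longrightarrow> Stab X n P \<subseteq> inverses M"
  using inverses_mono[of "Stab X n P" M] by (simp add: inverses_Stab)

lemma Sym_subset_inverses: "Sym X \<subseteq> inverses M \<longleftrightarrow> Sym X \<subseteq> M"
  using inverses_mono[of "Sym X" M] inverses_mono[of "Sym X" "inverses M"]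
  by (auto simp: inverses_Sym inverses_inverses)

text \<open>
  A permutation \<open>q\<close> that maps half of \<open>P 0\<close> into \<open>P 0\<close> and the other half into \<open>P 1\<close> relates \<open>0\<close>
  to two indices, and \<open>rho\<close> has full domain for every permutation of \<open>X\<close>.
\<close>

lemma not_Sym_subset_A_semi: "\<not> Sym X \<subseteq> A_semi X n P"
proof -
  have n01: "0 < n" "1 < n"
    using n_ge_2 by auto
  obtain A B where AB: "A \<union> B = P 0" "A \<inter> B = {}" "A \<approx> X" "B \<approx> X"
    using large_halves[OF P_large[OF n01(1)]] by blast
  obtain C D where CD: "C \<union> D = P 1" "C \<inter> D = {}" "C \<approx> X" "D \<approx> X"
    using large_halves[OF P_large[OF n01(2)]] by blast
  have P01: "P 0 \<inter> P 1 = {}"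
    using P_unique[OF n01] by auto
  define R where "R = X - (A \<union> B)"
  define S where "S = X - (A \<union> C)"
  have sub: "A \<subseteq> X" "B \<subseteq> X" "C \<subseteq> X" "D \<subseteq> X"
    using AB(1) CD(1) P_subset n01 by blast+
  have "P 1 \<subseteq> R"
    unfolding R_def using P_subset[OF n01(2)] AB(1) P01 by blast
  then have "R \<approx> X"
    using large_mono[OF P_large[OF n01(2)]] R_def by blast
  moreover have "D \<subseteq> S"
    unfolding S_def using CD AB(1) P01 sub(4) by blast
  then have "S \<approx> X"
    using large_mono[OF CD(4)] S_def by blast
  ultimately have RS: "R \<approx> S"
    using eqpoll_sym eqpoll_trans by blast
  have BC: "B \<approx> C"
    using AB(4) CD(3) eqpoll_sym eqpoll_trans by blast
  let ?D = "\<lambda>i::nat. if i = 0 then A else if i = 1 then B else R"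
  let ?E = "\<lambda>i::nat. if i = 0 then A else if i = 1 then C else S"
  have AC: "A \<inter> C = {}"
    using AB(1) CD(1) P01 by blast
  have fam1: "disjoint_family_on ?D {0, 1, 2}"
    using AB(2) unfolding disjoint_family_on_def R_def by auto
  have fam2: "disjoint_family_on ?E {0, 1, 2}"
    using AC unfolding disjoint_family_on_def S_def by auto
  obtain q where q: "single_valued q" "single_valued (q\<inverse>)"
    "Domain q = (\<Union>i\<in>{0, 1, 2}. ?D i)" "Range q = (\<Union>i\<in>{0, 1, 2}. ?E i)"
    "q \<subseteq> (\<Union>i\<in>{0, 1, 2}. ?D i \<times> ?E i)" "\<forall>i\<in>{0, 1, 2}. q `` ?D i = ?E i"
    by (rule glue_eqpoll_families[OF fam1 fam2]) (use BC RS in auto)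
  have DR: "Domain q = X" "Range q = X"
    using q(3,4) sub unfolding R_def S_def by auto
  have "q \<subseteq> Domain q \<times> Range q"
    by auto
  then have qI: "q \<in> sym_inv_monoid X"
    using q(1,2) DR by (simp add: sym_inv_monoid_def)
  have qA: "q `` A = A" "q `` B = C"
    using q(6) by auto
  have "q `` P 0 \<inter> P 0 \<approx> X"
    by (rule large_mono[OF AB(3)]) (use qA AB(1) P_subset[OF n01(1)] in blast)+
  then have 00: "(0, 0) \<in> rho X n P q"
    using n01 by (simp add: rho_iff)
  have "q `` P 0 \<inter> P 1 \<approx> X"
    by (rule large_mono[OF CD(3)]) (use qA AB(1) CD(1) P_subset[OF n01(2)] in blast)+
  then have 01: "(0, 1) \<in> rho X n P q"
    using n01 by (simp add: rho_iff)
  have "rho X n P q \<notin> Sym {..<n}"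
    using sym_inv_monoid_right_unique[OF _ 00 01] unfolding Sym_def by auto
  moreover have "Domain (rho X n P q) = {..<n}"
  proof
    show "{..<n} \<subseteq> Domain (rho X n P q)"
    proof
      fix i assume i: "i \<in> {..<n}"
      then have "P i \<subseteq> X"
        using P_subset by simp
      then have "q `` P i \<approx> P i"
        using sym_inv_monoid_Image_eqpoll[OF qI] DR(1) by blast
      then have "q `` P i \<approx> X"
        using P_large i eqpoll_trans by blast
      moreover have "q `` P i \<subseteq> X"
        using DR(2) by blast
      ultimately obtain j where "j < n" "P j \<inter> q `` P i \<approx> X"
        using ex_large_block by blast
      then show "i \<in> Domain (rho X n P q)"
        using i rho_iff[of i j q] by (auto simp: Int_commute)
    qed
  qed (use rho_in_square in blast)
  ultimately have "q \<notin> A_semi X n P"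
    by (simp add: A_semi_def)
  moreover have "q \<in> Sym X"
    using qI DR by (simp add: Sym_def)
  ultimately show ?thesis
    by blast
qed

lemma block_preserving_roomy_in_A_semi:
  assumes t: "roomy t" and tP: "\<forall>i<n. t `` P i \<subseteq> P i"
  shows "t \<in> A_semi X n P \<inter> inverses (A_semi X n P)"
proof -
  have tI: "t \<in> sym_inv_monoid X" "Domain t = X"
    using t unfolding roomy_def by blast+
  have "(i, j) \<in> rho X n P t \<longleftrightarrow> i < n \<and> j = id i" for i j
  proof
    assume "(i, j) \<in> rho X n P t"
    then have ij: "i < n" "j < n" "t `` P i \<inter> P j \<approx> X"
      by (auto simp: rho_iff)
    then show "i < n \<and> j = id i"
      using large_nonempty[OF ij(3)] tP P_unique by fastforce
  next
    assume ij: "i < n \<and> j = id i"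
    have "t `` P i \<approx> P i"
      using sym_inv_monoid_Image_eqpoll[OF tI(1)] tI(2) P_subset ij by blast
    then have "t `` P i \<approx> X"
      using ij P_large eqpoll_trans by blast
    moreover have "t `` P i \<inter> P i = t `` P i"
      using tP ij by blast
    ultimately show "(i, j) \<in> rho X n P t"
      using ij by (simp add: rho_iff)
  qed
  then have "rho X n P t = {(i, id i) | i. i \<in> {..<n}}"
    by auto
  then have "rho X n P t \<in> Sym {..<n}"
    using graph_of_bij_in_Sym[of id "{..<n}"] bij_betw_id by simp
  then show ?thesis
    using tI(1) inverses_A_semi by (simp add: A_semi_def)
qed

text \<open>
  Any second block has an empty image, so its index is not in the domain of the relation.
\<close>

lemma domain_in_block_imp_A_semi:
  assumes f: "f \<in> sym_inv_monoid X" and k: "k < n" "Domain f \<subseteq> P k"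
  shows "f \<in> A_semi X n P"
proof -
  obtain j where j: "j < n" "j \<noteq> k"
    using that[of "if k = 0 then 1 else 0"] n_ge_2 by (auto split: if_splits)
  have "f `` P j = {}"
    using k j P_unique by blast
  then have "j \<notin> Domain (rho X n P f)"
    using large_nonempty by (fastforce simp: rho_def)
  then show ?thesis
    using f j(1) by (auto simp: A_semi_def)
qed

lemma range_in_block_imp_inverses_A_semi:
  assumes f: "f \<in> sym_inv_monoid X" and k: "k < n" "Range f \<subseteq> P k"
  shows "f \<in> inverses (A_semi X n P)"
  using domain_in_block_imp_A_semi[OF sym_inv_monoid_converse[OF f] k(1)] k(2)
  by (simp add: inverses_iff)

lemma roomy_cancel:
  assumes "roomy f" and z: "z \<in> sym_inv_monoid X"
  shows "f O f\<inverse> O z = z" and "z O f O f\<inverse> = z"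
proof -
  have f: "f \<in> sym_inv_monoid X" "Domain f = X"
    using assms(1) unfolding roomy_def by blast+
  have "f O f\<inverse> = Id_on X"
    using f(2) sym_inv_monoid_left_unique[OF f(1)] by blast
  moreover have "Id_on X O z = z" "z O Id_on X = z"
    using sym_inv_monoid_in_carrier[OF z] by auto
  ultimately show "f O f\<inverse> O z = z" "z O f O f\<inverse> = z"
    by (metis O_assoc)+
qed

section \<open>Maximality\<close>

lemma A_semi_maximal: "maximal_subsemigroup (A_semi X n P) (sym_inv_monoid X)"
  unfolding maximal_subsemigroup_def
proof (intro conjI allI impI)
  show "A_semi X n P \<noteq> sym_inv_monoid X"
    using not_Sym_subset_A_semi unfolding Sym_def by blast
  fix N assume N: "subsemigroup N (sym_inv_monoid X) \<and> N \<noteq> sym_inv_monoid X \<and> A_semi X n P \<subseteq> N"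
  show "N = A_semi X n P"
  proof (rule ccontr)
    assume "N \<noteq> A_semi X n P"
    then have nA: "\<not> N \<subseteq> A_semi X n P"
      using N by blast
    obtain t where t: "roomy t" "\<forall>i<n. t `` P i \<subseteq> P i"
      by (rule ex_roomy_preserving_blocks)
    then have "t \<in> N"
      using block_preserving_roomy_in_A_semi N by blast
    moreover have "Stab X n P \<subseteq> N"
      using Stab_subset_A_semi N by blast
    ultimately obtain f k where f: "f \<in> N" "roomy f" "k < n" "Range f \<subseteq> P k"
      using ex_roomy_into_one_block[of N t] N t(1) nA by blast
    have fI: "f \<in> sym_inv_monoid X"
      using f(2) unfolding roomy_def by blast
    have "z \<in> N" if z: "z \<in> sym_inv_monoid X" for z
    proof -
      have "f\<inverse> O z \<in> A_semi X n P"
        by (rule domain_in_block_imp_A_semi[OF _ f(3)])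
          (use f(4) sym_inv_monoid_comp[OF sym_inv_monoid_converse[OF fI] z] in blast)+
      then have "f O (f\<inverse> O z) \<in> N"
        using subsemigroup_comp f(1) N by blast
      then show ?thesis
        using roomy_cancel(1)[OF f(2) z] by simp
    qed
    then show False
      using N unfolding subsemigroup_def by blast
  qed
qed (fact A_semi_subsemigroup)

lemma Sym_subset_if_not_subset_A_semi:
  assumes M: "subsemigroup M (sym_inv_monoid X)" "Stab X n P \<subseteq> M"
    and t: "t \<in> M" "roomy t" and t': "t' \<in> inverses M" "roomy t'"
    and nA: "\<not> M \<subseteq> A_semi X n P" "\<not> inverses M \<subseteq> A_semi X n P"
  shows "Sym X \<subseteq> M"
proof
  fix q assume q: "q \<in> Sym X"
  obtain f k where f: "f \<in> M" "roomy f" "k < n" "Range f \<subseteq> P k"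
    using ex_roomy_into_one_block[OF M t nA(1)] by blast
  obtain g l where g: "g \<in> inverses M" "roomy g" "l < n" "Range g \<subseteq> P l"
    using ex_roomy_into_one_block[OF subsemigroup_inverses[OF M(1)] Stab_subset_inverses[OF M(2)] t' nA(2)]
    by blast
  obtain s where s: "s \<in> Stab X n P" "f O s O g\<inverse> = q"
    using Sym_factors_through_one_block[OF f(2-4) g(2-4) q] by blast
  have "g\<inverse> \<in> M"
    using g(1) by (simp add: inverses_iff)
  then have "f O s O g\<inverse> \<in> M"
    using subsemigroup_comp[OF M(1)] f(1) s(1) M(2) by blast
  then show "q \<in> M"
    using s(2) by simp
qed

lemma maximal_imp_ex_roomy:
  assumes M: "maximal_subsemigroup M (sym_inv_monoid X)" "Stab X n P \<subseteq> M" "\<not> Sym X \<subseteq> M"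
  shows "\<exists>t\<in>M. roomy t"
proof (rule ccontr)
  assume "\<not> ?thesis"
  moreover have "subsemigroup M (sym_inv_monoid X)"
    using M(1) unfolding maximal_subsemigroup_def by blast
  ultimately obtain N where "subsemigroup N (sym_inv_monoid X)" "N \<noteq> sym_inv_monoid X" "M \<subseteq> N" "Sym X \<subseteq> N"
    using no_roomy_imp_in_proper_subsemigroup[of M] M(2) by blast
  then show False
    using M unfolding maximal_subsemigroup_def by blast
qed

text \<open>
  Both \<open>M\<close> and its inverse contain a roomy element, so one of them must lie in \<open>A_semi X n P\<close>,
  because otherwise \<open>M\<close> would contain all permutations.
\<close>

lemma maximal_cases:
  assumes M: "maximal_subsemigroup M (sym_inv_monoid X)" "Stab X n P \<subseteq> M" "\<not> Sym X \<subseteq> M"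
  shows "M = A_semi X n P \<or> M = inverses (A_semi X n P)"
proof -
  have sub: "subsemigroup M (sym_inv_monoid X)"
    using M(1) unfolding maximal_subsemigroup_def by blast
  have M': "maximal_subsemigroup (inverses M) (sym_inv_monoid X)" "Stab X n P \<subseteq> inverses M"
    "\<not> Sym X \<subseteq> inverses M"
    using M maximal_subsemigroup_inverses Stab_subset_inverses Sym_subset_inverses by auto
  obtain t where "t \<in> M" "roomy t"
    using maximal_imp_ex_roomy[OF M] by blast
  moreover obtain t' where "t' \<in> inverses M" "roomy t'"
    using maximal_imp_ex_roomy[OF M'] by blast
  ultimately have "M \<subseteq> A_semi X n P \<or> inverses M \<subseteq> A_semi X n P"
    using Sym_subset_if_not_subset_A_semi[OF sub M(2)] M(3) by blast
  then have "A_semi X n P = M \<or> A_semi X n P = inverses M"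
    using M(1) M'(1) A_semi_maximal unfolding maximal_subsemigroup_def by blast
  then show ?thesis
    using inverses_inverses by metis
qed

text \<open>
  An inverse subsemigroup that properly contains the intersection is not contained in
  \<open>A_semi X n P\<close>, since otherwise it would be contained in the inverse as well.
\<close>

lemma A_semi_Int_maximal:
  "maximal_inverse_subsemigroup (A_semi X n P \<inter> inverses (A_semi X n P)) (sym_inv_monoid X)"
  (is "maximal_inverse_subsemigroup ?B _")
  unfolding maximal_inverse_subsemigroup_def
proof (intro conjI allI impI)
  show "?B \<noteq> sym_inv_monoid X"
    using not_Sym_subset_A_semi unfolding Sym_def by blast
  fix N assume N: "inverse_subsemigroup N (sym_inv_monoid X) \<and> N \<noteq> sym_inv_monoid X \<and> ?B \<subseteq> N"
  then have sub: "subsemigroup N (sym_inv_monoid X)"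
    and inv: "\<And>f. f \<in> N \<Longrightarrow> f\<inverse> \<in> N" and invN: "inverses N = N"
    using inverse_subsemigroup_inverses_eq[of N] unfolding inverse_subsemigroup_def by blast+
  show "N = ?B"
  proof (rule ccontr)
    assume "N \<noteq> ?B"
    have nA: "\<not> N \<subseteq> A_semi X n P"
    proof
      assume "N \<subseteq> A_semi X n P"
      then have "N \<subseteq> ?B"
        using inverses_mono[of N "A_semi X n P"] invN by simp
      then show False
        using N \<open>N \<noteq> ?B\<close> by blast
    qed
    obtain t where t: "roomy t" "\<forall>i<n. t `` P i \<subseteq> P i"
      by (rule ex_roomy_preserving_blocks)
    then have "t \<in> N"
      using block_preserving_roomy_in_A_semi N by blast
    moreover have "Stab X n P \<subseteq> N"
      using Stab_subset_A_semi Stab_subset_inverses N by blast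
    ultimately obtain f k where f: "f \<in> N" "roomy f" "k < n" "Range f \<subseteq> P k"
      using ex_roomy_into_one_block[OF sub _ _ t(1) nA] by blast
    have fI: "f \<in> sym_inv_monoid X"
      using f(2) unfolding roomy_def by blast
    have "z \<in> N" if z: "z \<in> sym_inv_monoid X" for z
    proof -
      let ?y = "f\<inverse> O z O f"
      have yI: "?y \<in> sym_inv_monoid X"
        by (intro sym_inv_monoid_comp sym_inv_monoid_converse fI z)
      have "Domain ?y \<subseteq> P k" "Range ?y \<subseteq> P k"
        using f(4) by blast+
      then have "?y \<in> ?B"
        using domain_in_block_imp_A_semi[OF yI f(3)] range_in_block_imp_inverses_A_semi[OF yI f(3)]
        by blast
      then have "f O ?y O f\<inverse> \<in> N"
        using subsemigroup_comp[OF sub] f(1) inv N by blast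
      moreover have "f O ?y O f\<inverse> = z"
        using roomy_cancel[OF f(2) z] by (simp add: O_assoc)
      ultimately show ?thesis
        by simp
    qed
    then show False
      using N sub unfolding subsemigroup_def by blast
  qed
qed (fact inverse_subsemigroup_Int_inverses[OF A_semi_subsemigroup])

text \<open>
  The semigroup \<open>N\<close> that contains \<open>M\<close> when \<open>M\<close> has no roomy element need not be closed under
  inverses, but \<open>N \<inter> inverses N\<close> is, and it still contains \<open>M\<close> and all permutations.
\<close>

lemma maximal_inverse_unique:
  assumes M: "maximal_inverse_subsemigroup M (sym_inv_monoid X)" "Stab X n P \<subseteq> M" "\<not> Sym X \<subseteq> M"
  shows "M = A_semi X n P \<inter> inverses (A_semi X n P)"
proof -
  have inv: "inverse_subsemigroup M (sym_inv_monoid X)"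
    using M(1) unfolding maximal_inverse_subsemigroup_def by blast
  then have sub: "subsemigroup M (sym_inv_monoid X)"
    unfolding inverse_subsemigroup_def by blast
  have invM: "inverses M = M"
    by (rule inverse_subsemigroup_inverses_eq[OF inv])
  have "\<exists>t\<in>M. roomy t"
  proof (rule ccontr)
    assume "\<not> ?thesis"
    then obtain N where N: "subsemigroup N (sym_inv_monoid X)" "N \<noteq> sym_inv_monoid X" "M \<subseteq> N" "Sym X \<subseteq> N"
      using no_roomy_imp_in_proper_subsemigroup[OF sub M(2)] by blast
    have "M \<subseteq> N \<inter> inverses N"
      using N(3) inverses_mono[OF N(3)] invM by simp
    moreover have "Sym X \<subseteq> N \<inter> inverses N"
      using N(4) by (simp add: Sym_subset_inverses)
    moreover have "N \<inter> inverses N \<noteq> sym_inv_monoid X"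
      using N(1,2) unfolding subsemigroup_def by blast
    ultimately show False
      using M(1,3) inverse_subsemigroup_Int_inverses[OF N(1)]
      unfolding maximal_inverse_subsemigroup_def by blast
  qed
  then have "M \<subseteq> A_semi X n P"
    using Sym_subset_if_not_subset_A_semi[OF sub M(2)] M(3) invM by metis
  then have "M \<subseteq> A_semi X n P \<inter> inverses (A_semi X n P)"
    using inverses_mono[of M "A_semi X n P"] invM by simp
  then show ?thesis
    using M(1) A_semi_Int_maximal unfolding maximal_inverse_subsemigroup_def by blast
qed

end

theorem theorem3p12:
  fixes X :: "'a set" and n :: nat and P :: "nat \<Rightarrow> 'a set"
  assumes "infinite X" and "finite_partition X n P"
  shows "{M. maximal_subsemigroup M (sym_inv_monoid X) \<and> Stab X n P \<subseteq> M \<and> \<not> Sym X \<subseteq> M}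
           = {A_semi X n P, inverses (A_semi X n P)}
       \<and> inverses (A_semi X n P) = {f \<in> sym_inv_monoid X.
             rho X n P f \<in> Sym {..<n} \<or> Range (rho X n P f) \<noteq> {..<n}}
       \<and> {M. maximal_inverse_subsemigroup M (sym_inv_monoid X) \<and> Stab X n P \<subseteq> M \<and> \<not> Sym X \<subseteq> M}
           = {A_semi X n P \<inter> inverses (A_semi X n P)}
       \<and> A_semi X n P \<inter> inverses (A_semi X n P) = {f \<in> sym_inv_monoid X.
             rho X n P f \<in> Sym {..<n} \<or>
             (Domain (rho X n P f) \<noteq> {..<n} \<and> Range (rho X n P f) \<noteq> {..<n})}"
proof -
  interpret finitely_partitioned X n P
    using assms by unfold_locales
  have Stab: "Stab X n P \<subseteq> A_semi X n P" "Stab X n P \<subseteq> inverses (A_semi X n P)"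
    using Stab_subset_A_semi Stab_subset_inverses by blast+
  have Sym: "\<not> Sym X \<subseteq> A_semi X n P" "\<not> Sym X \<subseteq> inverses (A_semi X n P)"
    using not_Sym_subset_A_semi Sym_subset_inverses by blast+
  show ?thesis
  proof (intro conjI)
    show "{M. maximal_subsemigroup M (sym_inv_monoid X) \<and> Stab X n P \<subseteq> M \<and> \<not> Sym X \<subseteq> M}
        = {A_semi X n P, inverses (A_semi X n P)}"
    proof (intro set_eqI iffI)
      fix M assume "M \<in> {A_semi X n P, inverses (A_semi X n P)}"
      then show "M \<in> {M. maximal_subsemigroup M (sym_inv_monoid X) \<and> Stab X n P \<subseteq> M \<and> \<not> Sym X \<subseteq> M}"
        using A_semi_maximal maximal_subsemigroup_inverses[OF A_semi_maximal] Stab Sym by blast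
    qed (use maximal_cases in blast)
    show "{M. maximal_inverse_subsemigroup M (sym_inv_monoid X) \<and> Stab X n P \<subseteq> M \<and> \<not> Sym X \<subseteq> M}
        = {A_semi X n P \<inter> inverses (A_semi X n P)}"
    proof (intro set_eqI iffI)
      fix M assume "M \<in> {A_semi X n P \<inter> inverses (A_semi X n P)}"
      then show "M \<in> {M. maximal_inverse_subsemigroup M (sym_inv_monoid X) \<and> Stab X n P \<subseteq> M \<and> \<not> Sym X \<subseteq> M}"
        using A_semi_Int_maximal Stab Sym by blast
    qed (use maximal_inverse_unique in blast)
    show "A_semi X n P \<inter> inverses (A_semi X n P) = {f \<in> sym_inv_monoid X.
             rho X n P f \<in> Sym {..<n} \<or>
             (Domain (rho X n P f) \<noteq> {..<n} \<and> Range (rho X n P f) \<noteq> {..<n})}"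
      unfolding inverses_A_semi by (auto simp: A_semi_def)
  qed (fact inverses_A_semi)
qed

end
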